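(* Let $\boldsymbol k$ be an algebraically closed field with $\operatorname{char}\boldsymbol k\neq 2$, let $V$ be a vector space over $\boldsymbol k$ of finite dimension $n$, let $\mathcal C\subseteq V^*\otimes V^*\otimes V$ be the subspace of tensors fixed by the involution $\ell\otimes\ell'\otimes v\mapsto\ell'\otimes\ell\otimes v$, and let $G:=\mathrm{GL}(V)$ act naturally on $\mathcal C$. Then there exist two finite sets $\{s_p\}_{p\in P}$ and $\{t_q\}_{q\in Q}$ of nonconstant polynomial functions on $\mathcal C$ such that: (i) the closed subset $\mathcal S:=\{m\in\mathcal C\mid s_p(m)=0\ \forall p\in P\}$ is irreducible, and the map $\boldsymbol k(\mathcal C)^G\to\boldsymbol k(\mathcal S)$, $f\mapsto f|_{\mathcal S}$, is well defined and is a $\boldsymbol k$-isomorphism of fields; (ii) for every point $a$ of the open dense subset $\{m\in\mathcal C\mid t_q(m)\neq 0\ \forall q\in Q\}$ of $\mathcal C$ there exists a unique element $g\in G$ with $g\cdot a\in\mathcal S$.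
   Context: $\boldsymbol k(\mathcal C)^G$ denotes the field of $G$-invariant rational functions on $\mathcal C$; topology is the Zariski topology. *)

theory Defs
  imports "HOL-Computational_Algebra.Polynomial"
begin

(* Conventions: V = k^n with standard basis e_0..e_{n-1}.  An element of
   V* \<otimes> V* \<otimes> V is recorded by its coordinates t i j l (coefficient of
   e_i^* \<otimes> e_j^* \<otimes> e_l), with all coordinates outside {0..<n}^3 equal to 0. *)

type_synonym 'k tensor = "nat \<Rightarrow> nat \<Rightarrow> nat \<Rightarrow> 'k"
type_synonym 'k mat = "nat \<Rightarrow> nat \<Rightarrow> 'k"

definition alg_closed :: "'k::field itself \<Rightarrow> bool" where
  "alg_closed _ \<longleftrightarrow> (\<forall>p::'k poly. degree p > 0 \<longrightarrow> (\<exists>x. poly p x = 0))"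

definition symtens :: "nat \<Rightarrow> ('k::zero) tensor set" where
  "symtens n = {t. (\<forall>i j l. \<not> (i < n \<and> j < n \<and> l < n) \<longrightarrow> t i j l = 0)
                  \<and> (\<forall>i j l. t i j l = t j i l)}"

inductive_set polyfun :: "nat \<Rightarrow> (('k::comm_ring_1) tensor \<Rightarrow> 'k) set" for n where
  const: "(\<lambda>t. c) \<in> polyfun n"
| coord: "i < n \<Longrightarrow> j < n \<Longrightarrow> l < n \<Longrightarrow> (\<lambda>t. t i j l) \<in> polyfun n"
| add: "f \<in> polyfun n \<Longrightarrow> g \<in> polyfun n \<Longrightarrow> (\<lambda>t. f t + g t) \<in> polyfun n"
| mult: "f \<in> polyfun n \<Longrightarrow> g \<in> polyfun n \<Longrightarrow> (\<lambda>t. f t * g t) \<in> polyfun n"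

definition nonconst :: "nat \<Rightarrow> (('k::comm_ring_1) tensor \<Rightarrow> 'k) \<Rightarrow> bool" where
  "nonconst n f \<longleftrightarrow> \<not> (\<exists>c. \<forall>m\<in>symtens n. f m = c)"

definition is_mat_inv :: "nat \<Rightarrow> ('k::field) mat \<Rightarrow> 'k mat \<Rightarrow> bool" where
  "is_mat_inv n g h \<longleftrightarrow> (\<forall>i j. \<not> (i < n \<and> j < n) \<longrightarrow> h i j = 0)
     \<and> (\<forall>i<n. \<forall>j<n. (\<Sum>k<n. g i k * h k j) = (if i = j then 1 else 0))
     \<and> (\<forall>i<n. \<forall>j<n. (\<Sum>k<n. h i k * g k j) = (if i = j then 1 else 0))"

definition gl :: "nat \<Rightarrow> ('k::field) mat set" where
  "gl n = {g. (\<forall>i j. \<not> (i < n \<and> j < n) \<longrightarrow> g i j = 0) \<and> (\<exists>h. is_mat_inv n g h)}"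

definition gl_inv :: "nat \<Rightarrow> ('k::field) mat \<Rightarrow> 'k mat" where
  "gl_inv n g = (SOME h. is_mat_inv n g h)"

text \<open>Natural action: (g.m)(x,y) = g (m (g^-1 x, g^-1 y)).\<close>
definition act :: "nat \<Rightarrow> ('k::field) mat \<Rightarrow> 'k tensor \<Rightarrow> 'k tensor" where
  "act n g t = (\<lambda>i j l. if i < n \<and> j < n \<and> l < n then
      (\<Sum>a<n. \<Sum>b<n. \<Sum>c<n. g l c * t a b c * gl_inv n g a i * gl_inv n g b j) else 0)"

definition zclosed :: "nat \<Rightarrow> ('k::comm_ring_1) tensor set \<Rightarrow> bool" where
  "zclosed n X \<longleftrightarrow> (\<exists>F \<subseteq> polyfun n. X = {m \<in> symtens n. \<forall>f\<in>F. f m = 0})"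

definition zirreducible :: "nat \<Rightarrow> ('k::comm_ring_1) tensor set \<Rightarrow> bool" where
  "zirreducible n X \<longleftrightarrow> X \<noteq> {} \<and>
     (\<forall>A B. zclosed n A \<longrightarrow> zclosed n B \<longrightarrow> X \<subseteq> A \<union> B \<longrightarrow> X \<subseteq> A \<or> X \<subseteq> B)"

definition zdense :: "nat \<Rightarrow> ('k::comm_ring_1) tensor set \<Rightarrow> bool" where
  "zdense n U \<longleftrightarrow> U \<subseteq> symtens n \<and>
     (\<forall>A. zclosed n A \<longrightarrow> U \<subseteq> A \<longrightarrow> A = symtens n)"

text \<open>Rational functions on an (irreducible) subset X of C: fractions p/q of
  polynomial functions with q not identically 0 on X, where p/q = p'/q' iff
  p q' - p' q vanishes on X.  k(X) is the set of equivalence classes.\<close>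
type_synonym 'k frac = "('k tensor \<Rightarrow> 'k) \<times> ('k tensor \<Rightarrow> 'k)"

definition rat_rep :: "nat \<Rightarrow> ('k::field) tensor set \<Rightarrow> 'k frac set" where
  "rat_rep n X = {(p, q). p \<in> polyfun n \<and> q \<in> polyfun n \<and> (\<exists>m\<in>X. q m \<noteq> 0)}"

definition rat_eq :: "('k::field) tensor set \<Rightarrow> 'k frac \<Rightarrow> 'k frac \<Rightarrow> bool" where
  "rat_eq X r r' \<longleftrightarrow> (\<forall>m\<in>X. fst r m * snd r' m = fst r' m * snd r m)"

definition rat_class :: "nat \<Rightarrow> ('k::field) tensor set \<Rightarrow> 'k frac \<Rightarrow> 'k frac set" where
  "rat_class n X r = {r' \<in> rat_rep n X. rat_eq X r r'}"

definition fun_field :: "nat \<Rightarrow> ('k::field) tensor set \<Rightarrow> 'k frac set set" where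
  "fun_field n X = rat_class n X ` rat_rep n X"

definition rat_add :: "nat \<Rightarrow> ('k::field) tensor set \<Rightarrow> 'k frac set \<Rightarrow> 'k frac set \<Rightarrow> 'k frac set" where
  "rat_add n X F1 F2 = {r \<in> rat_rep n X. \<exists>r1\<in>F1. \<exists>r2\<in>F2.
      (\<exists>m\<in>X. snd r1 m * snd r2 m \<noteq> 0) \<and>
      rat_eq X r (\<lambda>m. fst r1 m * snd r2 m + fst r2 m * snd r1 m, \<lambda>m. snd r1 m * snd r2 m)}"

definition rat_mul :: "nat \<Rightarrow> ('k::field) tensor set \<Rightarrow> 'k frac set \<Rightarrow> 'k frac set \<Rightarrow> 'k frac set" where
  "rat_mul n X F1 F2 = {r \<in> rat_rep n X. \<exists>r1\<in>F1. \<exists>r2\<in>F2.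
      (\<exists>m\<in>X. snd r1 m * snd r2 m \<noteq> 0) \<and>
      rat_eq X r (\<lambda>m. fst r1 m * fst r2 m, \<lambda>m. snd r1 m * snd r2 m)}"

definition rat_const :: "nat \<Rightarrow> ('k::field) tensor set \<Rightarrow> 'k \<Rightarrow> 'k frac set" where
  "rat_const n X c = rat_class n X (\<lambda>m. c, \<lambda>m. 1)"

definition inv_fun_field :: "nat \<Rightarrow> ('k::field) frac set set" where
  "inv_fun_field n = {F \<in> fun_field n (symtens n). \<forall>r\<in>F. \<forall>g\<in>gl n.
      \<forall>m\<in>symtens n. fst r (act n g m) * snd r m = fst r m * snd r (act n g m)}"

definition rat_restrict :: "nat \<Rightarrow> ('k::field) tensor set \<Rightarrow> 'k frac set \<Rightarrow> 'k frac set" where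
  "rat_restrict n S F = {r' \<in> rat_rep n S. \<exists>r\<in>F. r \<in> rat_rep n S \<and> rat_eq S r r'}"

definition restriction_iso :: "nat \<Rightarrow> ('k::field) tensor set \<Rightarrow> bool" where
  "restriction_iso n S \<longleftrightarrow>
     (\<forall>F\<in>inv_fun_field n. (\<exists>r\<in>F. r \<in> rat_rep n S) \<and>
        (\<forall>r1\<in>F. \<forall>r2\<in>F. r1 \<in> rat_rep n S \<longrightarrow> r2 \<in> rat_rep n S \<longrightarrow> rat_eq S r1 r2))
   \<and> bij_betw (rat_restrict n S) (inv_fun_field n) (fun_field n S)
   \<and> (\<forall>F1\<in>inv_fun_field n. \<forall>F2\<in>inv_fun_field n.
        rat_restrict n S (rat_add n (symtens n) F1 F2)
          = rat_add n S (rat_restrict n S F1) (rat_restrict n S F2)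
      \<and> rat_restrict n S (rat_mul n (symtens n) F1 F2)
          = rat_mul n S (rat_restrict n S F1) (rat_restrict n S F2))
   \<and> (\<forall>c. rat_restrict n S (rat_const n (symtens n) c) = rat_const n S c)"

end

theory Submission
  imports Defs "Jordan_Normal_Form.Determinant"
begin

text \<open>
  For an algebra \<open>m\<close> let \<open>\<tau>(x) = trace L\<^bsub>x\<^esub>\<close> and \<open>\<gamma>(x, y) = \<tau>(x y)\<close>. If \<open>\<gamma>\<close> is nondegenerate, there is
  exactly one \<open>v\<close> with \<open>\<gamma>(v, x) = \<tau>(x)\<close> for all \<open>x\<close>; both \<open>v\<close> and the vectors \<open>v, v v, v (v v), \<dots>\<close> depend
  equivariantly and rationally on \<open>m\<close>, and for generic \<open>m\<close> the first \<open>n\<close> of them form a basis. Hence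
  exactly one group element takes this basis to the standard basis. In the normalized algebra
  \<open>e\<^sub>0 e\<^sub>i = e\<^bsub>i+1\<^esub>\<close> for \<open>i < n - 1\<close>, and \<open>\<tau>(e\<^sub>0 e\<^sub>i) = \<tau>(e\<^sub>i)\<close> says that all the traces \<open>\<tau>(e\<^sub>i)\<close> agree and that
  the coordinates of \<open>e\<^sub>0 e\<^bsub>n-1\<^esub>\<close> add up to 1. These conditions are affine-linear, so they cut out
  an irreducible \<open>S\<close>. Translating generic points into \<open>S\<close> extends a rational function on \<open>S\<close> to an
  invariant one.
\<close>

section \<open>Polynomial functions\<close>

lemma polyfun_minus:
  assumes "f \<in> polyfun n" "g \<in> polyfun n"
  shows "(\<lambda>m. f m - g m) \<in> polyfun n"
  using polyfun.add[OF assms(1) polyfun.mult[OF polyfun.const[of "-1"] assms(2)]] by simp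

lemma polyfun_sum:
  assumes "\<And>i. i \<in> I \<Longrightarrow> f i \<in> polyfun n"
  shows "(\<lambda>m. \<Sum>i\<in>I. f i m) \<in> polyfun n"
  using assms
  by (induction I rule: infinite_finite_induct) (auto intro: polyfun.const polyfun.add)

lemma polyfun_prod:
  assumes "\<And>i. i \<in> I \<Longrightarrow> f i \<in> polyfun n"
  shows "(\<lambda>m. \<Prod>i\<in>I. f i m) \<in> polyfun n"
  using assms
  by (induction I rule: infinite_finite_induct) (auto intro: polyfun.const polyfun.mult)

lemma polyfun_power:
  assumes "f \<in> polyfun n"
  shows "(\<lambda>m. f m ^ k) \<in> polyfun n"
  using assms by (induction k) (auto intro: polyfun.const polyfun.mult)

lemma polyfun_comp:
  assumes "f \<in> polyfun n"
    and "\<And>i j l. i < n \<Longrightarrow> j < n \<Longrightarrow> l < n \<Longrightarrow> (\<lambda>m. \<phi> m i j l) \<in> polyfun n"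
  shows "(\<lambda>m. f (\<phi> m)) \<in> polyfun n"
  using assms(1) by induction (auto intro: polyfun.intros assms(2))

text \<open>On a line a polynomial function becomes a one-variable polynomial, which reduces
  irreducibility questions to finiteness of roots.\<close>

lemma polyfun_line:
  fixes a b :: "'k::comm_ring_1 tensor"
  assumes "f \<in> polyfun n"
  shows "\<exists>p. \<forall>s. f (\<lambda>i j l. a i j l + s * (b i j l - a i j l)) = poly p s"
  using assms
proof induction
  case (const c)
  then show ?case by (intro exI[of _ "[:c:]"]) simp
next
  case (coord i j l)
  then show ?case by (intro exI[of _ "[:a i j l, b i j l - a i j l:]"]) simp
next
  case (add f g)
  then show ?case by (metis poly_add)
next
  case (mult f g)
  then show ?case by (metis poly_mult)
qed

section \<open>Irreducibility of affine sets\<close>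

definition affine_set :: "'k::comm_ring_1 tensor set \<Rightarrow> bool" where
  "affine_set X \<longleftrightarrow>
     (\<forall>a\<in>X. \<forall>b\<in>X. \<forall>s. (\<lambda>i j l. a i j l + s * (b i j l - a i j l)) \<in> X)"

text \<open>Nonempty, and the polynomial functions vanishing on \<open>X\<close> form a prime ideal:
  irreducibility in the form that calculations with fractions use.\<close>

definition poly_prime :: "nat \<Rightarrow> 'k::comm_ring_1 tensor set \<Rightarrow> bool" where
  "poly_prime n X \<longleftrightarrow> X \<noteq> {} \<and> (\<forall>f\<in>polyfun n. \<forall>g\<in>polyfun n.
     (\<exists>a\<in>X. f a \<noteq> 0) \<longrightarrow> (\<exists>b\<in>X. g b \<noteq> 0) \<longrightarrow> (\<exists>c\<in>X. f c \<noteq> 0 \<and> g c \<noteq> 0))"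

lemma poly_primeE:
  assumes "poly_prime n X" "f \<in> polyfun n" "g \<in> polyfun n"
    "a \<in> X" "f a \<noteq> 0" "b \<in> X" "g b \<noteq> 0"
  obtains c where "c \<in> X" "f c \<noteq> 0" "g c \<noteq> 0"
  using assms unfolding poly_prime_def by blast

text \<open>The nonvanishing points of \<open>q\<close> are dense in \<open>X\<close>, so an
  identity needs checking only where the denominators are nonzero.\<close>

lemma poly_prime_vanish:
  assumes "poly_prime n X" "f \<in> polyfun n" "q \<in> polyfun n" "a \<in> X" "q a \<noteq> 0"
    and "\<And>m. m \<in> X \<Longrightarrow> q m \<noteq> 0 \<Longrightarrow> f m = 0" and "m \<in> X"
  shows "f m = 0"
proof (rule ccontr)
  assume "f m \<noteq> 0"
  from poly_primeE[OF assms(1-3,7) this assms(4,5)] assms(6) show False by blast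
qed

text \<open>Over a finite field, one plus the product of all X - c has positive degree and takes the
  value 1 everywhere.\<close>

lemma alg_closed_infinite:
  assumes "alg_closed TYPE('k::field)"
  shows "infinite (UNIV :: 'k set)"
proof
  assume fin: "finite (UNIV :: 'k set)"
  define p :: "'k poly" where "p = (\<Prod>c\<in>UNIV. [:- c, 1:]) + 1"
  have "degree (\<Prod>c\<in>(UNIV::'k set). [:- c, 1:]) = card (UNIV :: 'k set)"
    by (subst degree_prod_sum_eq) auto
  moreover have "card (UNIV :: 'k set) > 0"
    using fin by (simp add: card_gt_0_iff)
  ultimately have "degree p > 0"
    unfolding p_def by (subst degree_add_eq_left) auto
  then obtain x where "poly p x = 0"
    using assms unfolding alg_closed_def by blast
  moreover have "poly p x = 1"
    unfolding p_def using fin by (auto simp: poly_prod intro: bexI[of _ x])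
  ultimately show False by simp
qed

text \<open>Join a point where \<open>f\<close> is nonzero to one where \<open>g\<close> is nonzero.
  Along this line both restrict to nonzero polynomials, whose product has only finitely many
  roots.\<close>

lemma affine_set_poly_prime:
  fixes X :: "'k::field tensor set"
  assumes "infinite (UNIV :: 'k set)" "affine_set X" "X \<noteq> {}"
  shows "poly_prime n X"
  unfolding poly_prime_def
proof (intro conjI ballI impI)
  fix f g :: "'k tensor \<Rightarrow> 'k"
  assume fg: "f \<in> polyfun n" "g \<in> polyfun n" and "\<exists>a\<in>X. f a \<noteq> 0" "\<exists>b\<in>X. g b \<noteq> 0"
  then obtain a b where ab: "a \<in> X" "f a \<noteq> 0" "b \<in> X" "g b \<noteq> 0" by blast
  define L where "L s = (\<lambda>i j l. a i j l + s * (b i j l - a i j l))" for s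
  obtain p where p: "f (L s) = poly p s" for s
    using polyfun_line[OF fg(1)] unfolding L_def by blast
  obtain q where q: "g (L s) = poly q s" for s
    using polyfun_line[OF fg(2)] unfolding L_def by blast
  have "L 0 = a" "L 1 = b" by (auto simp: L_def)
  with ab p[of 0] q[of 1] have "p * q \<noteq> 0" by auto
  then have "finite {s. poly (p * q) s = 0}"
    by (rule poly_roots_finite)
  then obtain s where "poly (p * q) s \<noteq> 0"
    using assms(1) by (metis (mono_tags, lifting) UNIV_eq_I mem_Collect_eq)
  moreover have "L s \<in> X"
    using assms(2) ab unfolding affine_set_def L_def by blast
  ultimately show "\<exists>c\<in>X. f c \<noteq> 0 \<and> g c \<noteq> 0"
    using p q by (metis mult_eq_0_iff poly_mult)
qed (use assms in blast)

text \<open>Two closed sets not containing \<open>X\<close> supply equations \<open>f\<close> and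
  \<open>g\<close> that are nonzero somewhere on \<open>X\<close>; a common nonvanishing point lies
  in neither set.\<close>

lemma zirreducible_poly_prime:
  assumes "poly_prime n X" "X \<subseteq> symtens n"
  shows "zirreducible n X"
  unfolding zirreducible_def
proof (intro conjI allI impI)
  show "X \<noteq> {}" using assms unfolding poly_prime_def by blast
next
  fix A B assume "zclosed n A" "zclosed n B" and sub: "X \<subseteq> A \<union> B"
  then obtain F G where F: "F \<subseteq> polyfun n" "A = {m \<in> symtens n. \<forall>f\<in>F. f m = 0}"
    and G: "G \<subseteq> polyfun n" "B = {m \<in> symtens n. \<forall>f\<in>G. f m = 0}"
    unfolding zclosed_def by blast
  show "X \<subseteq> A \<or> X \<subseteq> B"
  proof (rule ccontr)
    assume "\<not> (X \<subseteq> A \<or> X \<subseteq> B)"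
    then obtain f a g b where "f \<in> F" "a \<in> X" "f a \<noteq> 0" "g \<in> G" "b \<in> X" "g b \<noteq> 0"
      using F G assms(2) by blast
    then obtain c where "c \<in> X" "f c \<noteq> 0" "g c \<noteq> 0"
      using F G poly_primeE[OF assms(1), of f g a b] by blast
    then show False using sub F G \<open>f \<in> F\<close> \<open>g \<in> G\<close> by blast
  qed
qed

lemma zdense_nonvanishing:
  fixes t :: "'k::comm_ring_1 tensor \<Rightarrow> 'k"
  assumes "poly_prime n (symtens n :: 'k tensor set)"
    and "t \<in> polyfun n" "a \<in> symtens n" "t a \<noteq> 0"
  shows "zdense n {m \<in> symtens n. t m \<noteq> 0}"
  unfolding zdense_def
proof (intro conjI allI impI)
  fix A assume "zclosed n A" and sub: "{m \<in> symtens n. t m \<noteq> 0} \<subseteq> A"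
  then obtain F where F: "F \<subseteq> polyfun n" "A = {m \<in> symtens n. \<forall>f\<in>F. f m = 0}"
    unfolding zclosed_def by blast
  have "f m = 0" if "f \<in> F" "m \<in> symtens n" for f m
    by (rule poly_prime_vanish[where q = t and a = a and f = f])
       (use assms F sub that in \<open>auto\<close>)
  then show "A = symtens n" using F by blast
qed auto

section \<open>Localization at \<open>t\<close>: functions regular where \<open>t\<close> is
  nonzero, with arbitrary values elsewhere\<close>

definition regular ::
    "nat \<Rightarrow> ('k::field tensor \<Rightarrow> 'k) \<Rightarrow> ('k tensor \<Rightarrow> 'k) \<Rightarrow> bool" where
  "regular n t f \<longleftrightarrow> (\<exists>N. \<exists>P\<in>polyfun n. \<forall>m. t m \<noteq> 0 \<longrightarrow> f m * t m ^ N = P m)"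

lemma regular_polyfun: "f \<in> polyfun n \<Longrightarrow> regular n t f"
  unfolding regular_def by (intro exI[of _ 0]) auto

lemma regular_cong:
  assumes "\<And>m. t m \<noteq> 0 \<Longrightarrow> f m = g m" "regular n t g"
  shows "regular n t f"
  using assms unfolding regular_def by auto

lemma regular_add:
  assumes "t \<in> polyfun n" "regular n t f" "regular n t g"
  shows "regular n t (\<lambda>m. f m + g m)"
proof -
  from assms obtain N P M Q where
    P: "P \<in> polyfun n" "\<And>m. t m \<noteq> 0 \<Longrightarrow> f m * t m ^ N = P m" and
    Q: "Q \<in> polyfun n" "\<And>m. t m \<noteq> 0 \<Longrightarrow> g m * t m ^ M = Q m"
    unfolding regular_def by blast
  have "(\<lambda>m. P m * t m ^ M + Q m * t m ^ N) \<in> polyfun n"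
    by (intro polyfun.add polyfun.mult polyfun_power P Q assms)
  moreover have "(f m + g m) * t m ^ (N + M) = P m * t m ^ M + Q m * t m ^ N"
    if "t m \<noteq> 0" for m
    using P(2)[OF that, symmetric] Q(2)[OF that, symmetric]
    by (simp add: algebra_simps power_add)
  ultimately show ?thesis
    unfolding regular_def by (intro exI[of _ "N + M"] bexI) auto
qed

lemma regular_mult:
  assumes "regular n t f" "regular n t g"
  shows "regular n t (\<lambda>m. f m * g m)"
proof -
  from assms obtain N P M Q where
    P: "P \<in> polyfun n" "\<And>m. t m \<noteq> 0 \<Longrightarrow> f m * t m ^ N = P m" and
    Q: "Q \<in> polyfun n" "\<And>m. t m \<noteq> 0 \<Longrightarrow> g m * t m ^ M = Q m"
    unfolding regular_def by blast
  have "(\<lambda>m. P m * Q m) \<in> polyfun n"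
    by (intro polyfun.mult P Q)
  moreover have "(f m * g m) * t m ^ (N + M) = P m * Q m" if "t m \<noteq> 0" for m
    using P(2)[OF that, symmetric] Q(2)[OF that, symmetric]
    by (simp add: algebra_simps power_add)
  ultimately show ?thesis
    unfolding regular_def by (intro exI[of _ "N + M"] bexI) auto
qed

lemma regular_sum:
  assumes "t \<in> polyfun n" "\<And>i. i \<in> I \<Longrightarrow> regular n t (f i)"
  shows "regular n t (\<lambda>m. \<Sum>i\<in>I. f i m)"
  using assms(2)
  by (induction I rule: infinite_finite_induct)
     (auto intro: regular_polyfun polyfun.const regular_add assms(1))

lemma regular_power:
  assumes "regular n t f"
  shows "regular n t (\<lambda>m. f m ^ k)"
  using assms by (induction k) (auto intro: regular_polyfun polyfun.const regular_mult)

text \<open>If t = f g, then 1/f = g/t.\<close>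

lemma regular_inverse_factor:
  assumes "\<And>m. t m = f m * g m" "g \<in> polyfun n"
  shows "regular n t (\<lambda>m. inverse (f m))"
  unfolding regular_def by (intro exI[of _ 1] bexI[of _ g]) (auto simp: assms)

lemma regular_comp:
  assumes "f \<in> polyfun n" "t \<in> polyfun n"
    and "\<And>i j l. i < n \<Longrightarrow> j < n \<Longrightarrow> l < n \<Longrightarrow> regular n t (\<lambda>m. \<phi> m i j l)"
  shows "regular n t (\<lambda>m. f (\<phi> m))"
  using assms(1)
  by induction (auto intro: regular_polyfun polyfun.const regular_add regular_mult assms)

section \<open>The group action\<close>

definition mv :: "nat \<Rightarrow> 'k::comm_ring_1 Defs.mat \<Rightarrow> (nat \<Rightarrow> 'k) \<Rightarrow> nat \<Rightarrow> 'k" where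
  "mv n g x = (\<lambda>i. \<Sum>k<n. g i k * x k)"

definition mm :: "nat \<Rightarrow> 'k::comm_ring_1 Defs.mat \<Rightarrow> 'k Defs.mat \<Rightarrow> 'k Defs.mat" where
  "mm n g h = (\<lambda>i j. \<Sum>k<n. g i k * h k j)"

definition idm :: "nat \<Rightarrow> 'k::comm_ring_1 Defs.mat" where
  "idm n = (\<lambda>i j. if i < n \<and> j < n \<and> i = j then 1 else 0)"

text \<open>Reads \<open>m\<close> as the structure constants of an algebra on k^n, in general not
  associative; the points of \<open>symtens n\<close> give commutative ones.\<close>

definition mul :: "nat \<Rightarrow> 'k::comm_ring_1 tensor \<Rightarrow> (nat \<Rightarrow> 'k) \<Rightarrow> (nat \<Rightarrow> 'k) \<Rightarrow> nat \<Rightarrow> 'k" where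
  "mul n m x y = (\<lambda>l. \<Sum>a<n. \<Sum>b<n. m a b l * x a * y b)"

lemma mv_cong: "(\<And>i. i < n \<Longrightarrow> x i = y i) \<Longrightarrow> mv n g x = mv n g y"
  unfolding mv_def by (intro ext sum.cong) auto

lemma mul_cong:
  "(\<And>i. i < n \<Longrightarrow> x i = x' i) \<Longrightarrow> (\<And>i. i < n \<Longrightarrow> y i = y' i) \<Longrightarrow> mul n m x y = mul n m x' y'"
  unfolding mul_def by (intro ext sum.cong) auto

lemma mv_mm: "mv n (mm n g h) x = mv n g (mv n h x)"
proof
  fix i
  have "mv n (mm n g h) x i = (\<Sum>k<n. \<Sum>j<n. g i j * (h j k * x k))"
    unfolding mv_def mm_def by (simp add: sum_distrib_right mult.assoc)
  also have "\<dots> = (\<Sum>j<n. \<Sum>k<n. g i j * (h j k * x k))" by (rule sum.swap)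
  finally show "mv n (mm n g h) x i = mv n g (mv n h x) i"
    unfolding mv_def by (simp add: sum_distrib_left)
qed

lemma mv_idm: "i < n \<Longrightarrow> mv n (idm n) x i = x i"
  unfolding mv_def idm_def by (simp add: if_distrib[of "\<lambda>c. c * _"] cong: if_cong)

lemma mm_idm:
  assumes "i < n" "j < n"
  shows "mm n (idm n) g i j = g i j" "mm n g (idm n) i j = g i j"
  using assms unfolding mm_def idm_def
  by (simp_all add: if_distrib[of "\<lambda>c. c * _"] if_distrib[of "\<lambda>c. _ * c"] cong: if_cong)

lemma mm_cong:
  assumes "\<And>k. k < n \<Longrightarrow> g i k = g' i k" "\<And>k. k < n \<Longrightarrow> h k j = h' k j"
  shows "mm n g h i j = mm n g' h' i j"
  using assms unfolding mm_def by (intro sum.cong) auto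

lemma is_mat_inv_iff:
  "is_mat_inv n g h \<longleftrightarrow> (\<forall>i j. \<not> (i < n \<and> j < n) \<longrightarrow> h i j = 0)
     \<and> (\<forall>i<n. \<forall>j<n. mm n g h i j = idm n i j) \<and> (\<forall>i<n. \<forall>j<n. mm n h g i j = idm n i j)"
  unfolding is_mat_inv_def mm_def idm_def by auto

lemma mm_assoc: "mm n (mm n g h) k = mm n g (mm n h k)"
proof (intro ext)
  fix i j
  show "mm n (mm n g h) k i j = mm n g (mm n h k) i j"
    using fun_cong[OF mv_mm[of n g h "\<lambda>l. k l j"], of i] unfolding mv_def mm_def .
qed

text \<open>Inverses are required to vanish outside the n by n block, so uniqueness is equality of
  functions; it pins down the choice made in \<open>gl_inv\<close>.\<close>

lemma is_mat_inv_unique: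
  assumes "is_mat_inv n g h" "is_mat_inv n g h'"
  shows "h = h'"
proof (intro ext)
  fix i j
  show "h i j = h' i j"
  proof (cases "i < n \<and> j < n")
    case True
    have "h i j = mm n h (idm n) i j" using True by (simp add: mm_idm)
    also have "\<dots> = mm n h (mm n g h') i j"
      using True assms(2) unfolding is_mat_inv_iff by (intro mm_cong) auto
    also have "\<dots> = mm n (mm n h g) h' i j" by (simp add: mm_assoc)
    also have "\<dots> = mm n (idm n) h' i j"
      using True assms(1) unfolding is_mat_inv_iff by (intro mm_cong) auto
    also have "\<dots> = h' i j" using True by (simp add: mm_idm)
    finally show ?thesis .
  next
    case False
    then show ?thesis using assms unfolding is_mat_inv_def by auto
  qed
qed

lemma gl_inv_inverse: "g \<in> gl n \<Longrightarrow> is_mat_inv n g (gl_inv n g)"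
  unfolding gl_def gl_inv_def by (metis (mono_tags, lifting) mem_Collect_eq someI_ex)

lemma gl_inv_eq: "is_mat_inv n g h \<Longrightarrow> gl_inv n g = h"
  unfolding gl_inv_def by (rule some_equality) (auto dest: is_mat_inv_unique)

lemma gl_I:
  assumes "is_mat_inv n g h" "\<And>i j. \<not> (i < n \<and> j < n) \<Longrightarrow> g i j = 0"
  shows "g \<in> gl n"
  unfolding gl_def using assms by (intro CollectI conjI allI impI exI[of _ h])

lemma gl_outside: "g \<in> gl n \<Longrightarrow> \<not> (i < n \<and> j < n) \<Longrightarrow> g i j = 0"
  unfolding gl_def by blast

lemma is_mat_inv_sym: "is_mat_inv n g h \<Longrightarrow> g \<in> gl n \<Longrightarrow> is_mat_inv n h g"
  unfolding is_mat_inv_iff by (blast dest: gl_outside)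

lemma is_mat_inv_outside: "is_mat_inv n g h \<Longrightarrow> \<not> (i < n \<and> j < n) \<Longrightarrow> h i j = 0"
  unfolding is_mat_inv_iff by blast

lemma gl_inv_gl: "g \<in> gl n \<Longrightarrow> gl_inv n g \<in> gl n"
  using gl_I[OF is_mat_inv_sym[OF gl_inv_inverse]] is_mat_inv_outside[OF gl_inv_inverse] by blast

lemma mv_inverse:
  assumes "is_mat_inv n g h" "i < n"
  shows "mv n g (mv n h x) i = x i" "mv n h (mv n g x) i = x i"
proof -
  have "mv n g (mv n h x) i = mv n (idm n) x i"
    using assms unfolding mv_mm[symmetric] unfolding mv_def is_mat_inv_iff by simp
  then show "mv n g (mv n h x) i = x i" using assms mv_idm by metis
  have "mv n h (mv n g x) i = mv n (idm n) x i"
    using assms unfolding mv_mm[symmetric] unfolding mv_def is_mat_inv_iff by simp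
  then show "mv n h (mv n g x) i = x i" using assms mv_idm by metis
qed

lemma is_mat_inv_mm:
  assumes "is_mat_inv n g g'" "is_mat_inv n h h'"
  shows "is_mat_inv n (mm n g h) (mm n h' g')"
proof -
  \<comment> \<open>Products are read columnwise, so that \<open>mv_inverse\<close> cancels the
    inner pair.\<close>
  have *: "mm n a b i j = mv n a (\<lambda>l. b l j) i" for a b :: "'a Defs.mat" and i j
    unfolding mm_def mv_def ..
  have 1: "mm n (mm n a b) (mm n b' a') i j = idm n i j"
    if "is_mat_inv n a a'" "is_mat_inv n b b'" "i < n" "j < n" for a b a' b' :: "'a Defs.mat" and i j
  proof -
    have "mm n (mm n a b) (mm n b' a') i j = mv n a (\<lambda>l. mv n b (mv n b' (\<lambda>l. a' l j)) l) i"
      unfolding mm_assoc unfolding * ..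
    also have "\<dots> = mv n a (\<lambda>l. a' l j) i"
      using mv_inverse(1)[OF that(2)] by (intro fun_cong[OF mv_cong]) auto
    also have "\<dots> = idm n i j"
      using that unfolding is_mat_inv_iff * by auto
    finally show ?thesis .
  qed
  have 2: "mm n (mm n h' g') (mm n g h) i j = idm n i j" if "i < n" "j < n" for i j
  proof -
    have "mm n (mm n h' g') (mm n g h) i j = mv n h' (\<lambda>l. mv n g' (mv n g (\<lambda>l. h l j)) l) i"
      unfolding mm_assoc unfolding * ..
    also have "\<dots> = mv n h' (\<lambda>l. h l j) i"
      using mv_inverse(2)[OF assms(1)] by (intro fun_cong[OF mv_cong]) auto
    also have "\<dots> = idm n i j"
      using that assms unfolding is_mat_inv_iff * by auto
    finally show ?thesis .
  qed
  have "mm n h' g' i j = 0" if "\<not> (i < n \<and> j < n)" for i j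
    using assms[THEN is_mat_inv_outside] that unfolding mm_def by (auto intro!: sum.neutral)
  then show ?thesis
    using 1[OF assms] 2 unfolding is_mat_inv_iff by blast
qed

lemma gl_mm:
  assumes "g \<in> gl n" "h \<in> gl n"
  shows "mm n g h \<in> gl n"
  by (rule gl_I[OF is_mat_inv_mm[OF gl_inv_inverse gl_inv_inverse]])
     (use assms[THEN gl_outside] assms in \<open>auto simp: mm_def intro!: sum.neutral\<close>)

lemma gl_inv_mm:
  assumes "g \<in> gl n" "h \<in> gl n"
  shows "gl_inv n (mm n g h) = mm n (gl_inv n h) (gl_inv n g)"
  by (intro gl_inv_eq is_mat_inv_mm gl_inv_inverse assms)

lemma idm_gl: "idm n \<in> gl n" and gl_inv_idm: "gl_inv n (idm n) = idm n"
proof -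
  have "is_mat_inv n (idm n) (idm n)"
    unfolding is_mat_inv_iff by (simp add: mm_idm) (simp add: idm_def)
  then show "idm n \<in> gl n" "gl_inv n (idm n) = idm n"
    by (auto intro!: gl_I gl_inv_eq) (auto simp: idm_def split: if_splits)
qed

section \<open>The action on structure constants\<close>

lemma act_outside: "\<not> (i < n \<and> j < n \<and> l < n) \<Longrightarrow> act n g m i j l = 0"
  unfolding act_def by auto

text \<open>Column i of g^-1 is g^-1 e_i, so the triple sum regroups into the product of two such
  columns followed by \<open>g\<close>.\<close>

lemma act_eq_mv_mul:
  assumes "i < n" "j < n" "l < n"
  shows "act n g m i j l = mv n g (mul n m (\<lambda>a. gl_inv n g a i) (\<lambda>a. gl_inv n g a j)) l"
proof -
  have "act n g m i j l =
      (\<Sum>a<n. \<Sum>c<n. \<Sum>b<n. g l c * m a b c * gl_inv n g a i * gl_inv n g b j)"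
    unfolding act_def using assms by (simp only: if_True simp_thms) (intro sum.cong sum.swap refl)
  also have "\<dots> = (\<Sum>c<n. \<Sum>a<n. \<Sum>b<n. g l c * m a b c * gl_inv n g a i * gl_inv n g b j)"
    by (rule sum.swap)
  finally show ?thesis
    unfolding mv_def mul_def by (simp add: sum_distrib_left mult.assoc)
qed

lemma mul_linear:
  "mul n m (mv n h x) y l = (\<Sum>i<n. x i * mul n m (\<lambda>a. h a i) y l)"
  "mul n m x (mv n h y) l = (\<Sum>i<n. y i * mul n m x (\<lambda>a. h a i) l)"
proof -
  have "mul n m (mv n h x) y l = (\<Sum>a<n. \<Sum>b<n. \<Sum>i<n. x i * (m a b l * h a i * y b))"
    unfolding mul_def mv_def by (simp add: sum_distrib_left sum_distrib_right mult_ac)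
  also have "\<dots> = (\<Sum>a<n. \<Sum>i<n. \<Sum>b<n. x i * (m a b l * h a i * y b))"
    by (intro sum.cong sum.swap refl)
  also have "\<dots> = (\<Sum>i<n. \<Sum>a<n. \<Sum>b<n. x i * (m a b l * h a i * y b))"
    by (rule sum.swap)
  finally show "mul n m (mv n h x) y l = (\<Sum>i<n. x i * mul n m (\<lambda>a. h a i) y l)"
    unfolding mul_def by (simp add: sum_distrib_left)
  have "mul n m x (mv n h y) l = (\<Sum>a<n. \<Sum>b<n. \<Sum>i<n. y i * (m a b l * x a * h b i))"
    unfolding mul_def mv_def by (simp add: sum_distrib_left mult_ac)
  also have "\<dots> = (\<Sum>a<n. \<Sum>i<n. \<Sum>b<n. y i * (m a b l * x a * h b i))"
    by (intro sum.cong sum.swap refl)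
  also have "\<dots> = (\<Sum>i<n. \<Sum>a<n. \<Sum>b<n. y i * (m a b l * x a * h b i))"
    by (rule sum.swap)
  finally show "mul n m x (mv n h y) l = (\<Sum>i<n. y i * mul n m x (\<lambda>a. h a i) l)"
    unfolding mul_def by (simp add: sum_distrib_left)
qed

text \<open>For invertible \<open>g\<close> this says that \<open>g\<close> is an algebra
  isomorphism from \<open>m\<close> to \<open>act n g m\<close>; bilinearity extends the formula
  from basis vectors.\<close>

lemma mul_act:
  assumes "l < n"
  shows "mul n (act n g m) x y l = mv n g (mul n m (mv n (gl_inv n g) x) (mv n (gl_inv n g) y)) l"
proof -
  let ?h = "gl_inv n g"
  have "mv n g (mul n m (mv n ?h x) (mv n ?h y)) l =
      (\<Sum>k<n. \<Sum>i<n. \<Sum>j<n. g l k * (x i * (y j * mul n m (\<lambda>a. ?h a i) (\<lambda>a. ?h a j) k)))"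
    unfolding mv_def[of n g] by (simp add: mul_linear(1)) (simp add: mul_linear(2) sum_distrib_left)
  also have "\<dots> =
      (\<Sum>i<n. \<Sum>k<n. \<Sum>j<n. g l k * (x i * (y j * mul n m (\<lambda>a. ?h a i) (\<lambda>a. ?h a j) k)))"
    by (rule sum.swap)
  also have "\<dots> =
      (\<Sum>i<n. \<Sum>j<n. \<Sum>k<n. g l k * (x i * (y j * mul n m (\<lambda>a. ?h a i) (\<lambda>a. ?h a j) k)))"
    by (intro sum.cong sum.swap refl)
  also have "\<dots> = mul n (act n g m) x y l"
    unfolding mul_def[of n "act n g m"] using assms
    by (intro sum.cong refl) (simp add: act_eq_mv_mul mv_def sum_distrib_left sum_distrib_right mult_ac)
  finally show ?thesis ..
qed

lemma act_act:
  assumes "g \<in> gl n" "h \<in> gl n"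
  shows "act n g (act n h m) = act n (mm n g h) m"
proof (intro ext)
  fix i j l
  show "act n g (act n h m) i j l = act n (mm n g h) m i j l"
  proof (cases "i < n \<and> j < n \<and> l < n")
    case True
    let ?x = "\<lambda>i a. gl_inv n g a i"
    have eq: "(\<lambda>a. gl_inv n (mm n g h) a i) = mv n (gl_inv n h) (?x i)" for i
      unfolding gl_inv_mm[OF assms] by (simp add: mm_def mv_def)
    have "act n g (act n h m) i j l = mv n g (mul n (act n h m) (?x i) (?x j)) l"
      using True by (simp add: act_eq_mv_mul)
    also have "\<dots> = mv n g (mv n h (mul n m (mv n (gl_inv n h) (?x i)) (mv n (gl_inv n h) (?x j)))) l"
      by (intro fun_cong[OF mv_cong] mul_act)
    also have "\<dots> = act n (mm n g h) m i j l"
      using True by (simp add: act_eq_mv_mul eq mv_mm)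
    finally show ?thesis .
  qed (simp add: act_outside)
qed

lemma symtens_outside: "m \<in> symtens n \<Longrightarrow> \<not> (i < n \<and> j < n \<and> l < n) \<Longrightarrow> m i j l = 0"
  unfolding symtens_def by blast

lemma symtens_sym: "m \<in> symtens n \<Longrightarrow> m i j l = m j i l"
  unfolding symtens_def by blast

lemma act_idm:
  assumes "m \<in> symtens n"
  shows "act n (idm n) m = m"
proof (intro ext)
  fix i j l
  show "act n (idm n) m i j l = m i j l"
  proof (cases "i < n \<and> j < n \<and> l < n")
    case True
    then have "act n (idm n) m i j l = mul n m (\<lambda>a. idm n a i) (\<lambda>a. idm n a j) l"
      by (simp add: act_eq_mv_mul gl_inv_idm mv_idm)
    also have "\<dots> = (\<Sum>a<n. \<Sum>b<n. if b = j then if a = i then m a b l else 0 else 0)"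
      using True unfolding mul_def idm_def by (intro sum.cong refl) auto
    also have "\<dots> = m i j l" using True by simp
    finally show ?thesis .
  qed (use assms in \<open>simp add: act_outside symtens_outside\<close>)
qed

lemma act_gl_inv:
  assumes "g \<in> gl n" "m \<in> symtens n"
  shows "act n (gl_inv n g) (act n g m) = m"
proof -
  \<comment> \<open>\<open>act_idm\<close> speaks of \<open>idm n\<close> itself, so agreement is
    needed outside the block too, where both sides are zero.\<close>
  have "mm n (gl_inv n g) g i j = idm n i j" for i j
  proof (cases "i < n \<and> j < n")
    case True
    then show ?thesis using gl_inv_inverse[OF assms(1)] unfolding is_mat_inv_iff by blast
  next
    case False
    then show ?thesis
      using gl_outside[OF gl_mm[OF gl_inv_gl[OF assms(1)] assms(1)], of i j]
      by (auto simp: idm_def)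
  qed
  then have "mm n (gl_inv n g) g = idm n" by (intro ext)
  then show ?thesis
    using assms act_act gl_inv_gl act_idm by metis
qed

text \<open>Symmetry in the two covariant slots is commutativity of \<open>mul\<close>, which the
  formula for the action preserves.\<close>

lemma act_symtens:
  assumes "m \<in> symtens n"
  shows "act n g m \<in> symtens n"
proof -
  have "mul n m x y l = mul n m y x l" for x y l
    unfolding mul_def
    by (subst sum.swap, intro sum.cong refl, subst symtens_sym[OF assms]) (simp add: mult_ac)
  then have *: "mul n m x y = mul n m y x" for x y by (intro ext)
  have "act n g m i j l = act n g m j i l" for i j l
  proof (cases "i < n \<and> j < n \<and> l < n")
    case True
    then show ?thesis
      by (simp only: act_eq_mv_mul *[of "\<lambda>a. gl_inv n g a i" "\<lambda>a. gl_inv n g a j"])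
  next
    case False
    then show ?thesis by (subst (1 2) act_outside) auto
  qed
  then show ?thesis
    unfolding symtens_def using act_outside[of _ n _ _ g m] by simp
qed

text \<open>For fixed \<open>g\<close> the coordinates of \<open>act n g m\<close> are linear in
  \<open>m\<close>.\<close>

lemma polyfun_act:
  assumes "f \<in> polyfun n"
  shows "(\<lambda>m. f (act n g m)) \<in> polyfun n"
  by (rule polyfun_comp[OF assms])
     (auto simp: act_def intro!: polyfun_sum polyfun.mult polyfun.const polyfun.coord)

section \<open>Rational functions on a set and on an orbit section\<close>

text \<open>Primed letters are denominators. From a/a' = b/b' and b/b' = c/c' the conclusion follows
  only up to the factor \<open>b'\<close>, which may vanish at a given point.\<close>

lemma cross_trans:
  fixes a b c :: "'k::comm_ring_1"
  assumes "a * b' = b * a'" "b * c' = c * b'"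
  shows "b' * (a * c' - c * a') = 0"
proof -
  have "b' * (a * c' - c * a') = (a * b') * c' - (c * b') * a'" by (simp add: algebra_simps)
  also have "\<dots> = 0" unfolding assms(1) assms(2)[symmetric] by (simp add: algebra_simps)
  finally show ?thesis .
qed

lemma cross_add:
  fixes a b c d :: "'k::comm_ring_1"
  assumes "a * b' = b * a'" "c * d' = d * c'"
  shows "(a * c' + c * a') * (b' * d') = (b * d' + d * b') * (a' * c')"
proof -
  have "(a * c' + c * a') * (b' * d') = (a * b') * (c' * d') + (c * d') * (a' * b')"
    by (simp add: algebra_simps)
  also have "\<dots> = (b * d' + d * b') * (a' * c')" unfolding assms by (simp add: algebra_simps)
  finally show ?thesis .
qed

lemma cross_mult:
  fixes a b c d :: "'k::comm_ring_1"
  assumes "a * b' = b * a'" "c * d' = d * c'"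
  shows "a * c * (b' * d') = b * d * (a' * c')"
proof -
  have "a * c * (b' * d') = (a * b') * (c * d')" by (simp add: mult_ac)
  also have "\<dots> = b * d * (a' * c')" unfolding assms by (simp add: mult_ac)
  finally show ?thesis .
qed

section \<open>Fractions on a fixed set and their classes\<close>

definition frac_add :: "'k::field frac \<Rightarrow> 'k frac \<Rightarrow> 'k frac" where
  "frac_add r s = (\<lambda>m. fst r m * snd s m + fst s m * snd r m, \<lambda>m. snd r m * snd s m)"

definition frac_mul :: "'k::field frac \<Rightarrow> 'k frac \<Rightarrow> 'k frac" where
  "frac_mul r s = (\<lambda>m. fst r m * fst s m, \<lambda>m. snd r m * snd s m)"

lemma rat_repD:
  assumes "r \<in> rat_rep n X"
  shows "fst r \<in> polyfun n" "snd r \<in> polyfun n" "\<exists>m\<in>X. snd r m \<noteq> 0"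
  using assms unfolding rat_rep_def by auto

lemma rat_repI:
  assumes "p \<in> polyfun n" "q \<in> polyfun n" "a \<in> X" "q a \<noteq> 0"
  shows "(p, q) \<in> rat_rep n X"
  using assms unfolding rat_rep_def by auto

lemma rat_rep_mono: "r \<in> rat_rep n X \<Longrightarrow> X \<subseteq> Y \<Longrightarrow> r \<in> rat_rep n Y"
  unfolding rat_rep_def by auto

lemma rat_eq_refl: "rat_eq X r r"
  unfolding rat_eq_def by simp

lemma rat_eq_sym: "rat_eq X r s \<Longrightarrow> rat_eq X s r"
  unfolding rat_eq_def by simp

lemma rat_eq_mono: "rat_eq Y r s \<Longrightarrow> X \<subseteq> Y \<Longrightarrow> rat_eq X r s"
  unfolding rat_eq_def by auto

text \<open>Pointwise transitivity works only where the middle denominator is nonzero; primality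
  spreads the identity to all of \<open>X\<close>.\<close>

lemma rat_eq_trans:
  assumes X: "poly_prime n X" and rs: "r \<in> rat_rep n X" "s \<in> rat_rep n X" "u \<in> rat_rep n X"
    and eq: "rat_eq X r s" "rat_eq X s u"
  shows "rat_eq X r u"
proof -
  obtain a where a: "a \<in> X" "snd s a \<noteq> 0" using rat_repD(3)[OF rs(2)] by blast
  have pf: "(\<lambda>m. fst r m * snd u m - fst u m * snd r m) \<in> polyfun n"
    by (intro polyfun_minus polyfun.mult rat_repD[OF rs(1)] rat_repD[OF rs(3)])
  have "fst r m * snd u m - fst u m * snd r m = 0" if "m \<in> X" for m
  proof (rule poly_prime_vanish[OF X pf rat_repD(2)[OF rs(2)] a _ that])
    fix m assume m: "m \<in> X" "snd s m \<noteq> 0"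
    then have "fst r m * snd s m = fst s m * snd r m" "fst s m * snd u m = fst u m * snd s m"
      using eq unfolding rat_eq_def by auto
    then have "snd s m * (fst r m * snd u m - fst u m * snd r m) = 0" by (rule cross_trans)
    then show "fst r m * snd u m - fst u m * snd r m = 0" using m by simp
  qed
  then show ?thesis unfolding rat_eq_def by simp
qed

text \<open>Primality supplies one point where both denominators are nonzero.\<close>

lemma frac_rep:
  assumes X: "poly_prime n X" and rs: "r \<in> rat_rep n X" "s \<in> rat_rep n X"
  shows "frac_add r s \<in> rat_rep n X" "frac_mul r s \<in> rat_rep n X"
proof -
  note r = rat_repD[OF rs(1)] and s = rat_repD[OF rs(2)]
  obtain a b where "a \<in> X" "snd r a \<noteq> 0" "b \<in> X" "snd s b \<noteq> 0" using r s by blast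
  then obtain c where c: "c \<in> X" "snd r c \<noteq> 0" "snd s c \<noteq> 0"
    by (rule poly_primeE[OF X r(2) s(2)])
  show "frac_add r s \<in> rat_rep n X" "frac_mul r s \<in> rat_rep n X"
    unfolding frac_add_def frac_mul_def
    using c by (auto intro!: rat_repI polyfun.add polyfun.mult r s)
qed

lemma frac_add_cong:
  assumes "rat_eq X r r'" "rat_eq X s s'"
  shows "rat_eq X (frac_add r s) (frac_add r' s')"
  unfolding rat_eq_def frac_add_def
proof (clarsimp)
  fix m assume "m \<in> X"
  then have "fst r m * snd r' m = fst r' m * snd r m" "fst s m * snd s' m = fst s' m * snd s m"
    using assms unfolding rat_eq_def by auto
  then show "(fst r m * snd s m + fst s m * snd r m) * (snd r' m * snd s' m) =
      (fst r' m * snd s' m + fst s' m * snd r' m) * (snd r m * snd s m)"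
    by (rule cross_add)
qed

lemma frac_mul_cong:
  assumes "rat_eq X r r'" "rat_eq X s s'"
  shows "rat_eq X (frac_mul r s) (frac_mul r' s')"
  unfolding rat_eq_def frac_mul_def
proof (clarsimp)
  fix m assume "m \<in> X"
  then have "fst r m * snd r' m = fst r' m * snd r m" "fst s m * snd s' m = fst s' m * snd s m"
    using assms unfolding rat_eq_def by auto
  then show "fst r m * fst s m * (snd r' m * snd s' m) = fst r' m * fst s' m * (snd r m * snd s m)"
    by (rule cross_mult)
qed

lemma rat_class_self: "r \<in> rat_rep n X \<Longrightarrow> r \<in> rat_class n X r"
  unfolding rat_class_def using rat_eq_refl by blast

lemma rat_classD: "s \<in> rat_class n X r \<Longrightarrow> s \<in> rat_rep n X \<and> rat_eq X r s"
  unfolding rat_class_def by blast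

lemma rat_class_eqI:
  assumes "poly_prime n X" "r \<in> rat_rep n X" "s \<in> rat_rep n X" "rat_eq X r s"
  shows "rat_class n X r = rat_class n X s"
  unfolding rat_class_def
  using rat_eq_trans[OF assms(1)] rat_eq_sym[OF assms(4)] assms by blast

lemma rat_class_eqD:
  "rat_class n X r = rat_class n X s \<Longrightarrow> s \<in> rat_rep n X \<Longrightarrow> rat_eq X r s"
  using rat_class_self rat_classD by blast

lemma fun_fieldD:
  assumes "poly_prime n X" "F \<in> fun_field n X" "r \<in> F"
  shows "r \<in> rat_rep n X" "F = rat_class n X r"
proof -
  obtain s where s: "s \<in> rat_rep n X" "F = rat_class n X s"
    using assms(2) unfolding fun_field_def by blast
  then show r: "r \<in> rat_rep n X" using assms(3) rat_classD by blast
  show "F = rat_class n X r"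
    using rat_class_eqI[OF assms(1) s(1) r] rat_classD[of r n X s] assms(3) s(2) by blast
qed

text \<open>\<open>rat_add\<close> ranges over all representatives of the two classes; compatibility
  with equality of fractions lets a single pair compute it.\<close>

lemma rat_add_class:
  assumes X: "poly_prime n X" and rs: "r \<in> rat_rep n X" "s \<in> rat_rep n X"
  shows "rat_add n X (rat_class n X r) (rat_class n X s) = rat_class n X (frac_add r s)"
proof (intro equalityI subsetI)
  fix u assume "u \<in> rat_add n X (rat_class n X r) (rat_class n X s)"
  then obtain r' s' where u: "u \<in> rat_rep n X" "r' \<in> rat_class n X r" "s' \<in> rat_class n X s"
      "rat_eq X u (frac_add r' s')"
    unfolding rat_add_def frac_add_def by blast
  note r' = rat_classD[OF u(2)] and s' = rat_classD[OF u(3)]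
  have "rat_eq X (frac_add r s) u"
    using rat_eq_trans[OF X frac_rep(1)[OF X rs] frac_rep(1)[OF X, of r' s'] u(1)]
      frac_add_cong[of X r r' s s'] rat_eq_sym[OF u(4)] r' s' by blast
  then show "u \<in> rat_class n X (frac_add r s)" using u(1) unfolding rat_class_def by blast
next
  fix u assume "u \<in> rat_class n X (frac_add r s)"
  note u = rat_classD[OF this]
  have "\<exists>m\<in>X. snd r m * snd s m \<noteq> 0"
    using rat_repD(3)[OF frac_rep(1)[OF X rs]] unfolding frac_add_def by simp
  then show "u \<in> rat_add n X (rat_class n X r) (rat_class n X s)"
    using u rat_eq_sym[of X "frac_add r s" u] rat_class_self[OF rs(1)] rat_class_self[OF rs(2)]
    unfolding rat_add_def frac_add_def by blast
qed

lemma rat_mul_class: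
  assumes X: "poly_prime n X" and rs: "r \<in> rat_rep n X" "s \<in> rat_rep n X"
  shows "rat_mul n X (rat_class n X r) (rat_class n X s) = rat_class n X (frac_mul r s)"
proof (intro equalityI subsetI)
  fix u assume "u \<in> rat_mul n X (rat_class n X r) (rat_class n X s)"
  then obtain r' s' where u: "u \<in> rat_rep n X" "r' \<in> rat_class n X r" "s' \<in> rat_class n X s"
      "rat_eq X u (frac_mul r' s')"
    unfolding rat_mul_def frac_mul_def by blast
  note r' = rat_classD[OF u(2)] and s' = rat_classD[OF u(3)]
  have "rat_eq X (frac_mul r s) u"
    using rat_eq_trans[OF X frac_rep(2)[OF X rs] frac_rep(2)[OF X, of r' s'] u(1)]
      frac_mul_cong[of X r r' s s'] rat_eq_sym[OF u(4)] r' s' by blast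
  then show "u \<in> rat_class n X (frac_mul r s)" using u(1) unfolding rat_class_def by blast
next
  fix u assume "u \<in> rat_class n X (frac_mul r s)"
  note u = rat_classD[OF this]
  have "\<exists>m\<in>X. snd r m * snd s m \<noteq> 0"
    using rat_repD(3)[OF frac_rep(2)[OF X rs]] unfolding frac_mul_def by simp
  then show "u \<in> rat_mul n X (rat_class n X r) (rat_class n X s)"
    using u rat_eq_sym[of X "frac_mul r s" u] rat_class_self[OF rs(1)] rat_class_self[OF rs(2)]
    unfolding rat_mul_def frac_mul_def by blast
qed

text \<open>An abstract slice: the orbit of each point with \<open>t\<close> nonzero meets
  \<open>S\<close> in exactly one point \<open>R m\<close>, and \<open>R\<close> is rational with
  poles only along t = 0. Uniqueness here concerns the point, not the group element.\<close>

locale rational_section =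
  fixes n :: nat and S :: "'k::field tensor set" and t :: "'k tensor \<Rightarrow> 'k"
    and R :: "'k tensor \<Rightarrow> 'k tensor"
  assumes S_sub: "S \<subseteq> symtens n"
    and primeC: "poly_prime n (symtens n :: 'k tensor set)"
    and primeS: "poly_prime n S"
    and t_poly: "t \<in> polyfun n"
    and t_S: "\<exists>m\<in>S. t m \<noteq> 0"
    and R_regular: "\<And>i j l. i < n \<Longrightarrow> j < n \<Longrightarrow> l < n \<Longrightarrow> regular n t (\<lambda>m. R m i j l)"
    and R_orbit: "\<And>m. m \<in> symtens n \<Longrightarrow> t m \<noteq> 0 \<Longrightarrow> \<exists>g\<in>gl n. R m = act n g m"
    and R_S: "\<And>m. m \<in> symtens n \<Longrightarrow> t m \<noteq> 0 \<Longrightarrow> R m \<in> S"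
    and R_unique: "\<And>m g. m \<in> symtens n \<Longrightarrow> t m \<noteq> 0 \<Longrightarrow> g \<in> gl n \<Longrightarrow> act n g m \<in> S
                     \<Longrightarrow> act n g m = R m"
begin

lemma R_id: "m \<in> S \<Longrightarrow> t m \<noteq> 0 \<Longrightarrow> R m = m"
  using R_unique[of m "idm n"] idm_gl act_idm[of m n] subsetD[OF S_sub, of m] by metis

text \<open>\<open>R\<close> is constant along orbits where \<open>t\<close> is nonzero: compose the
  two group elements and use uniqueness of the intersection point.\<close>

lemma R_act:
  assumes "m \<in> symtens n" "g \<in> gl n" "t m \<noteq> 0" "t (act n g m) \<noteq> 0"
  shows "R (act n g m) = R m"
proof -
  obtain h where h: "h \<in> gl n" "R (act n g m) = act n h (act n g m)"
    using R_orbit[OF act_symtens[OF assms(1)] assms(4)] by blast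
  then have "R (act n g m) = act n (mm n h g) m" using act_act assms(2) by metis
  then show ?thesis
    using R_unique[OF assms(1,3) gl_mm[OF h(1) assms(2)]] R_S[OF act_symtens[OF assms(1)] assms(4)]
    by simp
qed

lemma inv_fun_fieldD:
  assumes "F \<in> inv_fun_field n" "r \<in> F" "g \<in> gl n" "m \<in> symtens n"
  shows "fst r (act n g m) * snd r m = fst r m * snd r (act n g m)"
  using assms unfolding inv_fun_field_def by blast

text \<open>An arbitrary representative of an invariant function may have a denominator vanishing on
  \<open>S\<close>; translating it by a suitable group element repairs this.\<close>
lemma inv_rep_on_S:
  assumes F: "F \<in> inv_fun_field n"
  shows "\<exists>r\<in>F. r \<in> rat_rep n S"
proof -
  have ff: "F \<in> fun_field n (symtens n)" using F unfolding inv_fun_field_def by blast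
  then obtain r where r: "r \<in> F"
    unfolding fun_field_def using rat_class_self by blast
  note rep = fun_fieldD[OF primeC ff r] note rD = rat_repD[OF rep(1)]
  obtain b where b: "b \<in> symtens n" "snd r b \<noteq> 0" using rD(3) by blast
  obtain c where c: "c \<in> S" "t c \<noteq> 0" using t_S by blast
  obtain a where a: "a \<in> symtens n" "snd r a \<noteq> 0" "t a \<noteq> 0"
    by (rule poly_primeE[OF primeC rD(2) t_poly b _ c(2)]) (use c S_sub in auto)
  obtain g where g: "g \<in> gl n" "R a = act n g a" using R_orbit a by blast
  \<comment> \<open>\<open>h\<close> carries the point \<open>R a\<close> of \<open>S\<close> back
    to \<open>a\<close>, where the denominator of \<open>r\<close> is nonzero; so translating
    \<open>r\<close> by \<open>h\<close> gives a denominator nonzero at \<open>R a\<close>.\<close>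
  define h where "h = gl_inv n g"
  have h: "h \<in> gl n" "act n h (R a) = a" using g a by (auto simp: h_def gl_inv_gl act_gl_inv)
  let ?s = "(\<lambda>m. fst r (act n h m), \<lambda>m. snd r (act n h m))"
  have RS: "R a \<in> S" using R_S a by blast
  have s: "?s \<in> rat_rep n S"
    by (rule rat_repI[OF polyfun_act[OF rD(1)] polyfun_act[OF rD(2)] RS]) (use a h in auto)
  have "rat_eq (symtens n) r ?s"
    unfolding rat_eq_def using inv_fun_fieldD[OF F r h(1)] by simp
  then have "?s \<in> F"
    using rat_rep_mono[OF s S_sub] by (subst rep(2)) (auto simp: rat_class_def)
  then show ?thesis using s by blast
qed

lemma inv_rep_eq_on_S:
  assumes "F \<in> inv_fun_field n" "r \<in> F" "s \<in> F"
  shows "rat_eq S r s"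
proof -
  have "F \<in> fun_field n (symtens n)" using assms unfolding inv_fun_field_def by blast
  then have "s \<in> rat_class n (symtens n) r" using fun_fieldD[OF primeC] assms by blast
  then show ?thesis using rat_classD rat_eq_mono S_sub by blast
qed

text \<open>Restriction can be computed on any representative whose denominator survives on
  \<open>S\<close>, because transitivity holds among such fractions.\<close>

lemma rat_restrict_class:
  assumes r: "r \<in> rat_rep n S"
  shows "rat_restrict n S (rat_class n (symtens n) r) = rat_class n S r"
proof (intro equalityI subsetI)
  fix u assume "u \<in> rat_restrict n S (rat_class n (symtens n) r)"
  then obtain s where s: "u \<in> rat_rep n S" "s \<in> rat_class n (symtens n) r" "s \<in> rat_rep n S"
      "rat_eq S s u"
    unfolding rat_restrict_def by blast
  then have "rat_eq S r s" using rat_classD rat_eq_mono S_sub by blast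
  then have "rat_eq S r u" using rat_eq_trans[OF primeS r s(3,1)] s(4) by blast
  then show "u \<in> rat_class n S r" using s unfolding rat_class_def by blast
next
  fix u assume "u \<in> rat_class n S r"
  then show "u \<in> rat_restrict n S (rat_class n (symtens n) r)"
    using r rat_class_self[OF rat_rep_mono[OF r S_sub]] rat_classD[of u n S r]
    unfolding rat_restrict_def by blast
qed

lemma inv_class_rep:
  assumes "F \<in> inv_fun_field n"
  obtains r where "r \<in> F" "r \<in> rat_rep n S" "r \<in> rat_rep n (symtens n)"
    "F = rat_class n (symtens n) r" "rat_restrict n S F = rat_class n S r"
proof -
  obtain r where r: "r \<in> F" "r \<in> rat_rep n S" using inv_rep_on_S assms by blast
  have "F \<in> fun_field n (symtens n)" using assms unfolding inv_fun_field_def by blast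
  then have F: "F = rat_class n (symtens n) r" using fun_fieldD(2)[OF primeC] r by blast
  then show thesis
    using that[OF r rat_rep_mono[OF r(2) S_sub] F] rat_restrict_class[OF r(2)] by simp
qed

text \<open>A polynomial pulled back along \<open>R\<close> becomes polynomial after multiplication
  by a power of \<open>t\<close>.\<close>

lemma regular_clear:
  assumes "f \<in> polyfun n"
  obtains N P where "P \<in> polyfun n" "\<And>m. t m \<noteq> 0 \<Longrightarrow> P m = f (R m) * t m ^ N"
proof -
  have "regular n t (\<lambda>m. f (R m))"
    by (rule regular_comp[OF assms t_poly R_regular])
  then show thesis using that unfolding regular_def by metis
qed

text \<open>At a generic m, invariance gives r(m) = r(R m) = s(R m) = s(m), the middle equality
  being agreement on \<open>S\<close>.\<close>

lemma restrict_inj: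
  assumes F: "F \<in> inv_fun_field n" and G: "G \<in> inv_fun_field n"
    and eq: "rat_restrict n S F = rat_restrict n S G"
  shows "F = G"
proof -
  obtain r where r: "r \<in> F" "r \<in> rat_rep n S" "r \<in> rat_rep n (symtens n)"
    "F = rat_class n (symtens n) r" "rat_restrict n S F = rat_class n S r"
    using inv_class_rep[OF F] .
  obtain s where s: "s \<in> G" "s \<in> rat_rep n S" "s \<in> rat_rep n (symtens n)"
    "G = rat_class n (symtens n) s" "rat_restrict n S G = rat_class n S s"
    using inv_class_rep[OF G] .
  have eqS: "rat_eq S r s"
    using rat_class_eqD[of n S r s] eq r(5) s(2,5) by simp
  note rD = rat_repD[OF r(2)] and sD = rat_repD[OF s(2)]
  obtain N P where P: "P \<in> polyfun n" "\<And>m. t m \<noteq> 0 \<Longrightarrow> P m = snd r (R m) * t m ^ N"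
    using regular_clear[OF rD(2)] by metis
  obtain M Q where Q: "Q \<in> polyfun n" "\<And>m. t m \<noteq> 0 \<Longrightarrow> Q m = snd s (R m) * t m ^ M"
    using regular_clear[OF sD(2)] by metis
  \<comment> \<open>\<open>R\<close> fixes this point of \<open>S\<close>, so it shows that the test
    function \<open>?q\<close> below is not identically zero.\<close>
  obtain a where a: "a \<in> S" "snd r a \<noteq> 0 \<and> snd s a \<noteq> 0 \<and> t a \<noteq> 0"
  proof -
    obtain x y z where x: "x \<in> S" "snd r x \<noteq> 0" and y: "y \<in> S" "snd s y \<noteq> 0"
      and z: "z \<in> S" "t z \<noteq> 0" using rD(3) sD(3) t_S by blast
    obtain b where b: "b \<in> S" "snd r b \<noteq> 0" "snd s b \<noteq> 0"
      by (rule poly_primeE[OF primeS rD(2) sD(2) x y])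
    then have "snd r b * snd s b \<noteq> 0" by simp
    from poly_primeE[OF primeS polyfun.mult[OF rD(2) sD(2)] t_poly b(1) this z] that
    show thesis by auto
  qed
  let ?q = "\<lambda>m. P m * (Q m * t m)"
  let ?f = "\<lambda>m. fst r m * snd s m - fst s m * snd r m"
  have q: "?q \<in> polyfun n" by (intro polyfun.mult P(1) Q(1) t_poly)
  have f: "?f \<in> polyfun n" by (intro polyfun_minus polyfun.mult rD sD)
  have qa: "?q a \<noteq> 0" using P(2)[of a] Q(2)[of a] a R_id[of a] by simp
  have aC: "a \<in> symtens n" using a S_sub by blast
  have "?f m = 0" if "m \<in> symtens n" for m
  proof (rule poly_prime_vanish[OF primeC f q aC qa _ that])
    fix m assume m: "m \<in> symtens n" "?q m \<noteq> 0"
    then have tm: "t m \<noteq> 0" by auto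
    have nz: "snd r (R m) \<noteq> 0" "snd s (R m) \<noteq> 0" using m P(2)[OF tm] Q(2)[OF tm] by auto
    obtain g where g: "g \<in> gl n" "R m = act n g m" using R_orbit m tm by blast
    have 1: "fst r (R m) * snd r m = fst r m * snd r (R m)"
      using inv_fun_fieldD[OF F r(1) g(1) m(1)] g(2) by simp
    have 2: "fst s (R m) * snd s m = fst s m * snd s (R m)"
      using inv_fun_fieldD[OF G s(1) g(1) m(1)] g(2) by simp
    have 3: "fst r (R m) * snd s (R m) = fst s (R m) * snd r (R m)"
      using eqS R_S[OF m(1) tm] unfolding rat_eq_def by blast
    \<comment> \<open>By invariance this turns into a multiple of the cross difference of
      \<open>r\<close> and \<open>s\<close> at \<open>R m\<close>, which vanishes by
      \<open>3\<close>.\<close>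
    have "(snd r (R m) * snd s (R m)) * ?f m
        = (fst r m * snd r (R m)) * (snd s (R m) * snd s m)
          - (fst s m * snd s (R m)) * (snd r (R m) * snd r m)"
      by (simp add: algebra_simps)
    also have "\<dots> = (snd r m * snd s m)
        * (fst r (R m) * snd s (R m) - fst s (R m) * snd r (R m))"
      unfolding 1[symmetric] 2[symmetric] by (simp add: algebra_simps)
    finally have "(snd r (R m) * snd s (R m)) * ?f m = 0" using 3 by simp
    then show "?f m = 0" using nz by simp
  qed
  then have "rat_eq (symtens n) r s" unfolding rat_eq_def by simp
  then show ?thesis using rat_class_eqI[OF primeC r(3) s(3)] r(4) s(4) by blast
qed

text \<open>The preimage is \<open>r\<close> composed with \<open>R\<close>: it is constant on
  generic orbits, and restricts to \<open>r\<close> since \<open>R\<close> fixes generic points of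
  \<open>S\<close>.\<close>

lemma restrict_surj:
  assumes r: "r \<in> rat_rep n S"
  shows "\<exists>F\<in>inv_fun_field n. rat_restrict n S F = rat_class n S r"
proof -
  note rD = rat_repD[OF r]
  obtain N P where P: "P \<in> polyfun n" "\<And>m. t m \<noteq> 0 \<Longrightarrow> P m = fst r (R m) * t m ^ N"
    using regular_clear[OF rD(1)] by metis
  obtain M Q where Q: "Q \<in> polyfun n" "\<And>m. t m \<noteq> 0 \<Longrightarrow> Q m = snd r (R m) * t m ^ M"
    using regular_clear[OF rD(2)] by metis
  \<comment> \<open>The crossed powers of \<open>t\<close> give numerator and denominator the common
    factor t^(N + M), so \<open>u\<close> represents \<open>r\<close> composed with
    \<open>R\<close>.\<close>
  define u where "u = (\<lambda>m. P m * t m ^ M, \<lambda>m. Q m * t m ^ N)"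
  have u: "fst u m = fst r (R m) * t m ^ (N + M)" "snd u m = snd r (R m) * t m ^ (N + M)"
    if "t m \<noteq> 0" for m
    using P(2)[OF that] Q(2)[OF that] by (simp_all add: u_def power_add mult_ac)
  have upoly: "fst u \<in> polyfun n" "snd u \<in> polyfun n"
    unfolding u_def by (auto intro!: polyfun.mult P Q polyfun_power t_poly)
  obtain x z where x: "x \<in> S" "snd r x \<noteq> 0" and z: "z \<in> S" "t z \<noteq> 0" using rD(3) t_S by blast
  obtain a where a: "a \<in> S" "snd r a \<noteq> 0" "t a \<noteq> 0"
    by (rule poly_primeE[OF primeS rD(2) t_poly x z])
  have uS: "u \<in> rat_rep n S"
    using rat_repI[OF upoly a(1)] u(2)[OF a(3)] R_id[OF a(1,3)] a by simp
  have uC: "u \<in> rat_rep n (symtens n)" by (rule rat_rep_mono[OF uS S_sub])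
  have inv: "fst u (act n g m) * snd u m = fst u m * snd u (act n g m)"
    if g: "g \<in> gl n" and m: "m \<in> symtens n" for g m
  proof -
    let ?f = "\<lambda>m. fst u (act n g m) * snd u m - fst u m * snd u (act n g m)"
    let ?q = "\<lambda>m. t m * t (act n g m)"
    have f: "?f \<in> polyfun n" by (intro polyfun_minus polyfun.mult upoly polyfun_act)
    have q: "?q \<in> polyfun n" by (intro polyfun.mult t_poly polyfun_act)
    have aC: "a \<in> symtens n" using a S_sub by blast
    \<comment> \<open>Moving \<open>a\<close> back by \<open>g\<close> gives a point where the
      translate of \<open>t\<close> is nonzero; hence some \<open>b\<close> has \<open>t\<close>
      nonzero both before and after translation.\<close>
    have "act n g (act n (gl_inv n g) a) = a"
      using act_gl_inv[OF gl_inv_gl[OF g] aC] gl_inv_eq[OF is_mat_inv_sym[OF gl_inv_inverse[OF g] g]]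
      by simp
    then have ta: "t (act n g (act n (gl_inv n g) a)) \<noteq> 0" using a by simp
    obtain b where b: "b \<in> symtens n" "t b \<noteq> 0" "t (act n g b) \<noteq> 0"
    proof (rule poly_primeE[where f = t and g = "\<lambda>m. t (act n g m)" and a = a
          and b = "act n (gl_inv n g) a"])
      show "(\<lambda>m. t (act n g m)) \<in> polyfun n" by (rule polyfun_act[OF t_poly])
    qed (use primeC t_poly aC a(3) ta act_symtens[OF aC] in auto)
    then have qb: "?q b \<noteq> 0" by simp
    have "?f m = 0"
    proof (rule poly_prime_vanish[where f = ?f and q = ?q and a = b, OF primeC f q b(1) qb _ m])
      fix m assume m: "m \<in> symtens n" "?q m \<noteq> 0"
      then have "t m \<noteq> 0" "t (act n g m) \<noteq> 0" by auto
      then show "?f m = 0" using u R_act[OF m(1) g] by simp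
    qed
    then show ?thesis by simp
  qed
  let ?F = "rat_class n (symtens n) u"
  \<comment> \<open>\<open>inv_fun_field\<close> asks for invariance of every representative
    \<open>s\<close>, not just \<open>u\<close>. With \<open>?T\<close> for translation by
    \<open>g\<close>, the chain of equal fractions is ?T s, ?T u, u, s.\<close>
  have inv': "fst s (act n g m) * snd s m = fst s m * snd s (act n g m)"
    if s: "s \<in> ?F" and g: "g \<in> gl n" and m: "m \<in> symtens n" for s g m
  proof -
    note sC = rat_classD[OF s]
    let ?T = "\<lambda>w. (\<lambda>m. fst w (act n g m), \<lambda>m. snd w (act n g m))"
    have T: "?T w \<in> rat_rep n (symtens n)" if w: "w \<in> rat_rep n (symtens n)" for w
    proof -
      obtain b where b: "b \<in> symtens n" "snd w b \<noteq> 0" using rat_repD(3)[OF w] by blast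
      have "act n g (act n (gl_inv n g) b) = b"
        using act_gl_inv[OF gl_inv_gl[OF g] b(1)]
          gl_inv_eq[OF is_mat_inv_sym[OF gl_inv_inverse[OF g] g]] by simp
      then show ?thesis
        using rat_repI[OF polyfun_act[OF rat_repD(1)[OF w]] polyfun_act[OF rat_repD(2)[OF w]]
            act_symtens[OF b(1), of "gl_inv n g"]] b by simp
    qed
    have 1: "rat_eq (symtens n) (?T s) (?T u)"
      using sC unfolding rat_eq_def by (simp add: act_symtens)
    have 2: "rat_eq (symtens n) (?T u) u"
      using inv[OF g] unfolding rat_eq_def by simp
    have sr: "s \<in> rat_rep n (symtens n)" using sC by blast
    have "rat_eq (symtens n) (?T s) s"
      using rat_eq_trans[OF primeC T[OF sr] uC sr rat_eq_trans[OF primeC T[OF sr] T[OF uC] uC 1 2]]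
        sC by blast
    then show ?thesis using m unfolding rat_eq_def by simp
  qed
  have "?F \<in> inv_fun_field n"
    using uC inv' unfolding inv_fun_field_def fun_field_def by blast
  moreover have "rat_eq S u r"
  proof -
    let ?f = "\<lambda>m. fst u m * snd r m - fst r m * snd u m"
    have f: "?f \<in> polyfun n" by (intro polyfun_minus polyfun.mult upoly rD)
    have "?f m = 0" if "m \<in> S" for m
      by (rule poly_prime_vanish[OF primeS f t_poly z _ that]) (simp add: u R_id)
    then show ?thesis unfolding rat_eq_def by simp
  qed
  ultimately show ?thesis
    using rat_restrict_class[OF uS] rat_class_eqI[OF primeS uS r] by metis
qed

lemma restriction_iso_section: "restriction_iso n S"
  unfolding restriction_iso_def
proof (intro conjI ballI allI)
  fix F :: "'k frac set" assume F: "F \<in> inv_fun_field n"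
  show "\<exists>r\<in>F. r \<in> rat_rep n S" by (rule inv_rep_on_S[OF F])
  show "r1 \<in> rat_rep n S \<longrightarrow> r2 \<in> rat_rep n S \<longrightarrow> rat_eq S r1 r2" if "r1 \<in> F" "r2 \<in> F" for r1 r2
    using inv_rep_eq_on_S[OF F that] by blast
next
  show "bij_betw (rat_restrict n S) (inv_fun_field n) (fun_field n S)"
    unfolding bij_betw_def
  proof (intro conjI equalityI subsetI)
    show "inj_on (rat_restrict n S) (inv_fun_field n)" by (rule inj_onI) (rule restrict_inj)
  next
    fix H assume "H \<in> rat_restrict n S ` inv_fun_field n"
    then obtain F where F: "F \<in> inv_fun_field n" "H = rat_restrict n S F" by blast
    from inv_class_rep[OF F(1)] show "H \<in> fun_field n S"
      unfolding F(2) fun_field_def by blast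
  next
    fix H assume "H \<in> fun_field n S"
    then obtain r where "r \<in> rat_rep n S" "H = rat_class n S r" unfolding fun_field_def by blast
    then show "H \<in> rat_restrict n S ` inv_fun_field n" using restrict_surj by blast
  qed
next
  fix F1 F2 :: "'k frac set" assume F: "F1 \<in> inv_fun_field n" "F2 \<in> inv_fun_field n"
  obtain r where "r \<in> F1" and r: "r \<in> rat_rep n S" "r \<in> rat_rep n (symtens n)"
    "F1 = rat_class n (symtens n) r" "rat_restrict n S F1 = rat_class n S r"
    using inv_class_rep[OF F(1)] .
  obtain s where "s \<in> F2" and s: "s \<in> rat_rep n S" "s \<in> rat_rep n (symtens n)"
    "F2 = rat_class n (symtens n) s" "rat_restrict n S F2 = rat_class n S s"
    using inv_class_rep[OF F(2)] .
  \<comment> \<open>Sums and products of fractions defined on \<open>S\<close> stay defined on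
    \<open>S\<close>, so \<open>rat_restrict_class\<close> applies to them.\<close>
  note rep = frac_rep[OF primeS r(1) s(1)]
  show "rat_restrict n S (rat_add n (symtens n) F1 F2)
      = rat_add n S (rat_restrict n S F1) (rat_restrict n S F2)"
    unfolding r(4) s(4) rat_add_class[OF primeS r(1) s(1)]
    unfolding r(3) s(3) rat_add_class[OF primeC r(2) s(2)] by (rule rat_restrict_class[OF rep(1)])
  show "rat_restrict n S (rat_mul n (symtens n) F1 F2)
      = rat_mul n S (rat_restrict n S F1) (rat_restrict n S F2)"
    unfolding r(4) s(4) rat_mul_class[OF primeS r(1) s(1)]
    unfolding r(3) s(3) rat_mul_class[OF primeC r(2) s(2)] by (rule rat_restrict_class[OF rep(2)])
next
  fix c
  obtain a where "a \<in> S" using t_S by blast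
  then show "rat_restrict n S (rat_const n (symtens n) c) = rat_const n S c"
    unfolding rat_const_def
    by (intro rat_restrict_class rat_repI[OF polyfun.const polyfun.const, of a]) simp_all
qed

end

section \<open>The normal form\<close>

definition tr :: "nat \<Rightarrow> 'k::comm_ring_1 tensor \<Rightarrow> nat \<Rightarrow> 'k" where
  "tr n m a = (\<Sum>i<n. m a i i)"

text \<open>The symmetric bilinear form \<open>(x, y) \<mapsto> trace L\<^bsub>xy\<^esub>\<close>, where \<open>L\<^bsub>z\<^esub>\<close> is multiplication by \<open>z\<close>.\<close>
definition gam :: "nat \<Rightarrow> 'k::comm_ring_1 tensor \<Rightarrow> nat \<Rightarrow> nat \<Rightarrow> 'k" where
  "gam n m a b = (\<Sum>l<n. m a b l * tr n m l)"

text \<open>Left powers of \<open>u\<close>; the index starts at zero, so entry \<open>i\<close> is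
  a product of i + 1 copies of \<open>u\<close>.\<close>

primrec kry :: "nat \<Rightarrow> 'k::comm_ring_1 tensor \<Rightarrow> (nat \<Rightarrow> 'k) \<Rightarrow> nat \<Rightarrow> nat \<Rightarrow> 'k" where
  "kry n m u 0 = u"
| "kry n m u (Suc i) = mul n m u (kry n m u i)"

text \<open>The first clause makes multiplication by e_0 a shift except on the last basis vector.
  The other two are affine replacements for the quadratic condition gam(e_0, x) = tr(x), with a
  common trace factor divided out. For \<open>n = 0\<close> the sum is empty, hence the
  guard.\<close>

definition normal_form :: "nat \<Rightarrow> 'k::comm_ring_1 tensor set" where
  "normal_form n = {m \<in> symtens n.
     (\<forall>i l. Suc i < n \<longrightarrow> l < n \<longrightarrow> m 0 i l = (if l = Suc i then 1 else 0))
     \<and> (0 < n \<longrightarrow> (\<Sum>l<n. m 0 (n - 1) l) = 1)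
     \<and> (\<forall>j<n. tr n m j = m 0 (n - 1) (n - 1))}"

lemma normal_formD:
  assumes "m \<in> normal_form n"
  shows "m \<in> symtens n"
    "Suc i < n \<Longrightarrow> l < n \<Longrightarrow> m 0 i l = (if l = Suc i then 1 else 0)"
    "0 < n \<Longrightarrow> (\<Sum>l<n. m 0 (n - 1) l) = 1"
    "j < n \<Longrightarrow> tr n m j = m 0 (n - 1) (n - 1)"
  using assms unfolding normal_form_def by auto

lemma gam_sym: "m \<in> symtens n \<Longrightarrow> gam n m a b = gam n m b a"
  unfolding gam_def by (intro sum.cong refl arg_cong2[of _ _ _ _ times] symtens_sym)

text \<open>So e_0 represents the trace through \<open>gam\<close>. Below the last index this
  compares consecutive traces; at the last one the common trace factors out of a coordinate sum
  equal to 1.\<close>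

lemma normal_form_gam:
  assumes m: "m \<in> normal_form n" and j: "j < n"
  shows "gam n m 0 j = tr n m j"
proof (cases "Suc j < n")
  case True
  then have "gam n m 0 j = (\<Sum>l<n. if l = Suc j then tr n m l else 0)"
    unfolding gam_def by (intro sum.cong refl) (simp add: normal_formD(2)[OF m])
  also have "\<dots> = tr n m (Suc j)" using True by simp
  finally show ?thesis using normal_formD(4)[OF m] True j by simp
next
  case False
  then have j: "j = n - 1" "0 < n" using j by auto
  have "gam n m 0 j = (\<Sum>l<n. m 0 (n - 1) l * m 0 (n - 1) (n - 1))"
    unfolding gam_def j(1) by (intro sum.cong refl) (simp add: normal_formD(4)[OF m])
  also have "\<dots> = m 0 (n - 1) (n - 1)"
    unfolding sum_distrib_right[symmetric] normal_formD(3)[OF m j(2)] by simp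
  finally show ?thesis using normal_formD(4)[OF m] j by simp
qed

text \<open>A converse to \<open>normal_form_gam\<close>: a nonzero trace lets the common factor be
  cancelled, which yields the coordinate sum 1.\<close>

lemma normal_formI:
  fixes m :: "'k::field tensor"
  assumes m: "m \<in> symtens n"
    and e: "\<And>i l. Suc i < n \<Longrightarrow> l < n \<Longrightarrow> m 0 i l = (if l = Suc i then 1 else 0)"
    and g: "\<And>j. j < n \<Longrightarrow> gam n m 0 j = tr n m j"
    and nz: "0 < n \<Longrightarrow> \<exists>j<n. tr n m j \<noteq> 0"
  shows "m \<in> normal_form n"
proof (cases "n = 0")
  case True
  then show ?thesis using m unfolding normal_form_def by simp
next
  case False
  have step: "tr n m (Suc j) = tr n m j" if "Suc j < n" for j
  proof -
    have "gam n m 0 j = (\<Sum>l<n. if l = Suc j then tr n m l else 0)"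
      unfolding gam_def using that by (intro sum.cong refl) (simp add: e)
    also have "\<dots> = tr n m (Suc j)" using that by simp
    finally show ?thesis using g[of j] that by simp
  qed
  have const: "tr n m j = tr n m 0" if "j < n" for j
    using that by (induction j) (auto simp: step)
  \<comment> \<open>Multiplication by e_0 is a shift, so only its last diagonal entry can be
    nonzero.\<close>
  have "tr n m 0 = (\<Sum>i<n. if i = n - 1 then m 0 i i else 0)"
    unfolding tr_def
  proof (intro sum.cong refl)
    fix i assume "i \<in> {..<n}"
    then show "m 0 i i = (if i = n - 1 then m 0 i i else 0)"
      using e[of i i] by (cases "i = n - 1") auto
  qed
  then have c: "tr n m 0 = m 0 (n - 1) (n - 1)" using False by simp
  have "tr n m 0 = gam n m 0 (n - 1)" using g[of "n - 1"] const[of "n - 1"] False by simp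
  also have "\<dots> = (\<Sum>l<n. m 0 (n - 1) l * tr n m 0)"
    unfolding gam_def by (intro sum.cong refl arg_cong2[of _ _ _ _ times] const) auto
  also have "\<dots> = (\<Sum>l<n. m 0 (n - 1) l) * tr n m 0" by (simp add: sum_distrib_right)
  finally have eq: "tr n m 0 = (\<Sum>l<n. m 0 (n - 1) l) * tr n m 0" .
  have "tr n m 0 \<noteq> 0" using nz const False by (metis gr0I)
  with eq have "(\<Sum>l<n. m 0 (n - 1) l) = 1" by simp
  moreover have "tr n m j = m 0 (n - 1) (n - 1)" if "j < n" for j using const[OF that] c by simp
  ultimately show ?thesis using m e unfolding normal_form_def by blast
qed

section \<open>Affineness of the ambient space and of the normal form\<close>

lemma symtens_affine: "affine_set (symtens n)"
  unfolding affine_set_def symtens_def by auto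

lemma tr_line:
  "tr n (\<lambda>i j l. a i j l + s * (b i j l - a i j l)) j = tr n a j + s * (tr n b j - tr n a j)"
  unfolding tr_def by (simp add: sum.distrib sum_distrib_left sum_subtractf right_diff_distrib)

lemma normal_form_affine: "affine_set (normal_form n)"
  unfolding affine_set_def
proof (intro ballI allI)
  fix a b :: "'a tensor" and s assume a: "a \<in> normal_form n" and b: "b \<in> normal_form n"
  let ?L = "\<lambda>i j l. a i j l + s * (b i j l - a i j l)"
  have "?L \<in> symtens n"
    using symtens_affine normal_formD(1)[OF a] normal_formD(1)[OF b]
    unfolding affine_set_def by blast
  moreover have "(\<Sum>l<n. ?L 0 (n - 1) l) = 1" if "0 < n"
    using normal_formD(3)[OF a that] normal_formD(3)[OF b that]
    by (simp add: sum.distrib sum_distrib_left[symmetric] sum_subtractf)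
  moreover have "?L 0 i l = (if l = Suc i then 1 else 0)" if "Suc i < n" "l < n" for i l
    using normal_formD(2)[OF a that] normal_formD(2)[OF b that] by simp
  moreover have "tr n ?L j = ?L 0 (n - 1) (n - 1)" if "j < n" for j
    using normal_formD(4)[OF a that] normal_formD(4)[OF b that] by (simp add: tr_line)
  ultimately show "?L \<in> normal_form n"
    unfolding normal_form_def by blast
qed

text \<open>A point of the normal form at which \<open>gam\<close> is nondegenerate in every characteristic:
  \<open>e\<^sub>0 e\<^sub>i = e\<^bsub>min (i+1) (n-1)\<^esub>\<close>, \<open>e\<^sub>i e\<^sub>i = e\<^sub>i - e\<^sub>0\<close> and \<open>e\<^sub>i e\<^sub>j = e\<^sub>0\<close> for distinct \<open>i, j \<ge> 1\<close>.\<close>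
definition witness :: "nat \<Rightarrow> 'k::comm_ring_1 tensor" where
  "witness n = (\<lambda>i j l. if \<not> (i < n \<and> j < n \<and> l < n) then 0
     else if i = 0 then (if l = min (Suc j) (n - 1) then 1 else 0)
     else if j = 0 then (if l = min (Suc i) (n - 1) then 1 else 0)
     else if i = j then (if l = i then 1 else 0) - (if l = 0 then 1 else 0)
     else if l = 0 then 1 else 0)"

lemma witness_symtens: "witness n \<in> symtens n"
  unfolding symtens_def witness_def by auto

text \<open>Multiplication by e_j has a single nonzero diagonal entry, at position n - 1 for j = 0
  and at position j otherwise.\<close>

lemma tr_witness:
  assumes "j < n"
  shows "tr n (witness n :: 'k::comm_ring_1 tensor) j = 1"
proof -
  have "tr n (witness n :: 'k tensor) j = (\<Sum>i<n. if i = (if j = 0 then n - 1 else j) then 1 else 0)"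
    unfolding tr_def witness_def using assms by (intro sum.cong refl) (auto simp: min_def)
  then show ?thesis using assms by simp
qed

text \<open>As all traces are 1, \<open>gam\<close> is the coordinate sum of e_i e_j; it is zero
  exactly for the products e_i - e_0.\<close>

lemma gam_witness:
  assumes "i < n" "j < n"
  shows "gam n (witness n :: 'k::comm_ring_1 tensor) i j = (if i = j \<and> i \<noteq> 0 then 0 else 1)"
proof -
  have "gam n (witness n :: 'k tensor) i j = (\<Sum>l<n. witness n i j l)"
    unfolding gam_def by (intro sum.cong refl) (simp add: tr_witness)
  also have "\<dots> = (if i = j \<and> i \<noteq> 0 then 0 else 1)"
    using assms unfolding witness_def
    by (cases "i = 0"; cases "j = 0"; cases "i = j"; simp add: sum_subtractf min_def) auto
  finally show ?thesis .
qed

lemma witness_normal_form: "(witness n :: 'k::field tensor) \<in> normal_form n"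
proof (rule normal_formI[OF witness_symtens])
  fix i l assume "Suc i < n" "l < n"
  then show "(witness n :: 'k tensor) 0 i l = (if l = Suc i then 1 else 0)"
    unfolding witness_def by (auto simp: min_def)
qed (auto simp: gam_witness tr_witness)

text \<open>The Gram matrix is the all-ones matrix minus diag(0, 1, ..., 1). Row 0 makes the
  coordinate sum vanish, the other rows then kill each x_i with i > 0, and the sum finally kills
  x_0.\<close>

lemma gam_witness_nondegenerate:
  fixes x :: "nat \<Rightarrow> 'k::field"
  assumes "\<And>i. i < n \<Longrightarrow> (\<Sum>j<n. gam n (witness n) i j * x j) = 0" and "j < n"
  shows "x j = 0"
proof -
  have eq: "(\<Sum>j<n. gam n (witness n) i j * x j)
      = (\<Sum>j<n. x j) - (\<Sum>j<n. if j = i \<and> i \<noteq> 0 then x j else 0)" if "i < n" for i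
    unfolding sum_subtractf[symmetric]
    by (intro sum.cong refl) (use that in \<open>auto simp: gam_witness\<close>)
  have s: "(\<Sum>j<n. x j) = 0" using assms(1)[of 0] eq[of 0] assms(2) by simp
  have pos: "x i = 0" if "i < n" "i \<noteq> 0" for i
    using assms(1)[OF that(1)] eq[OF that(1)] s that by simp
  have "(\<Sum>j<n. x j) = (\<Sum>j<n. if j = 0 then x j else 0)"
    by (intro sum.cong refl) (use pos in auto)
  then have "x 0 = 0" using s assms(2) by simp
  then show ?thesis using pos assms(2) by (cases "j = 0") auto
qed

section \<open>Equivariance of the trace form\<close>

text \<open>Applying g^-1 cancels the outer \<open>g\<close> in the action and leaves the product of
  the columns of g^-1 in the old algebra.\<close>

lemma act_pull:
  assumes g: "g \<in> gl n" and "i < n" "j < n" "p < n"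
  shows "(\<Sum>l<n. gl_inv n g p l * act n g m i j l)
    = mul n m (\<lambda>a. gl_inv n g a i) (\<lambda>a. gl_inv n g a j) p"
proof -
  let ?y = "mul n m (\<lambda>a. gl_inv n g a i) (\<lambda>a. gl_inv n g a j)"
  have "(\<Sum>l<n. gl_inv n g p l * act n g m i j l) = mv n (gl_inv n g) (mv n g ?y) p"
    unfolding mv_def[of n "gl_inv n g"] using assms
    by (intro sum.cong refl) (simp add: act_eq_mv_mul)
  then show ?thesis using mv_inverse(2)[OF gl_inv_inverse[OF g] assms(4)] by simp
qed

text \<open>Multiplication operators are conjugated by \<open>g\<close>, which preserves traces;
  thus \<open>tr\<close> is pulled back as a covector.\<close>

lemma tr_act:
  assumes g: "g \<in> gl n" and j: "j < n"
  shows "tr n (act n g m) j = (\<Sum>a<n. gl_inv n g a j * tr n m a)"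
proof -
  let ?h = "\<lambda>i a. gl_inv n g a i"
  have "tr n (act n g m) j = (\<Sum>i<n. \<Sum>k<n. g i k * mul n m (?h j) (?h i) k)"
    unfolding tr_def using j by (intro sum.cong refl) (simp add: act_eq_mv_mul mv_def)
  also have "\<dots> = (\<Sum>k<n. \<Sum>i<n. g i k * mul n m (?h j) (?h i) k)"
    by (rule sum.swap)
  \<comment> \<open>By linearity the sum over \<open>i\<close> contracts \<open>g\<close> with its
    inverse, leaving the identity.\<close>
  also have "\<dots> = (\<Sum>k<n. mul n m (?h j) (mv n (gl_inv n g) (\<lambda>i. g i k)) k)"
    by (simp add: mul_linear(2))
  also have "\<dots> = (\<Sum>k<n. mul n m (?h j) (\<lambda>a. idm n a k) k)"
  proof (intro sum.cong refl fun_cong[OF mul_cong])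
    fix k a assume "k \<in> {..<n}" "a < n"
    then show "mv n (gl_inv n g) (\<lambda>i. g i k) a = idm n a k"
      using gl_inv_inverse[OF g] unfolding is_mat_inv_iff by (auto simp: mm_def mv_def)
  qed
  also have "\<dots> = (\<Sum>k<n. \<Sum>a<n. m a k k * gl_inv n g a j)"
  proof (intro sum.cong refl)
    fix k assume k: "k \<in> {..<n}"
    have "mul n m (?h j) (\<lambda>a. idm n a k) k
        = (\<Sum>a<n. \<Sum>b<n. if b = k then m a b k * gl_inv n g a j else 0)"
      unfolding mul_def idm_def using k by (intro sum.cong refl) auto
    then show "mul n m (?h j) (\<lambda>a. idm n a k) k = (\<Sum>a<n. m a k k * gl_inv n g a j)"
      using k by simp
  qed
  also have "\<dots> = (\<Sum>a<n. \<Sum>k<n. m a k k * gl_inv n g a j)" by (rule sum.swap)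
  finally show ?thesis
    unfolding tr_def by (simp add: sum_distrib_left mult.commute)
qed

lemma sum_matrix_cancel:
  assumes "is_mat_inv n g h" "c < n"
  shows "(\<Sum>j<n. (\<Sum>a<n. h a j * x a) * g j c) = (x c :: 'k::field)"
proof -
  have "(\<Sum>j<n. (\<Sum>a<n. h a j * x a) * g j c) = (\<Sum>j<n. \<Sum>a<n. x a * (h a j * g j c))"
    by (simp add: sum_distrib_left sum_distrib_right mult_ac)
  also have "\<dots> = (\<Sum>a<n. \<Sum>j<n. x a * (h a j * g j c))" by (rule sum.swap)
  also have "\<dots> = (\<Sum>a<n. if a = c then x a else 0)"
    unfolding sum_distrib_left[symmetric] using assms
    by (intro sum.cong refl) (auto simp: is_mat_inv_def)
  finally show ?thesis using assms(2) by simp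
qed

lemma tr_pull:
  assumes "g \<in> gl n" "c < n"
  shows "(\<Sum>j<n. tr n (act n g m) j * g j c) = tr n m c"
  using sum_matrix_cancel[OF gl_inv_inverse[OF assms(1)] assms(2), of "tr n m"] assms
  by (simp add: tr_act)

text \<open>Invariance of the trace form. The first argument is summed innermost so that
  \<open>sum_matrix_cancel\<close> can undo the change of basis in the second.\<close>

lemma gam_act:
  assumes g: "g \<in> gl n" and ij: "i < n" "j < n"
  shows "gam n (act n g m) i j
    = (\<Sum>b<n. gl_inv n g b j * (\<Sum>a<n. gam n m a b * gl_inv n g a i))"
proof -
  let ?h = "gl_inv n g"
  have "gam n (act n g m) i j = (\<Sum>l<n. \<Sum>p<n. tr n m p * (?h p l * act n g m i j l))"
    unfolding gam_def
    by (intro sum.cong refl) (simp add: tr_act[OF g] sum_distrib_left mult_ac)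
  also have "\<dots> = (\<Sum>p<n. \<Sum>l<n. tr n m p * (?h p l * act n g m i j l))" by (rule sum.swap)
  also have "\<dots> = (\<Sum>p<n. tr n m p * mul n m (\<lambda>a. ?h a i) (\<lambda>a. ?h a j) p)"
    unfolding sum_distrib_left[symmetric] by (intro sum.cong refl) (simp add: act_pull[OF g ij])
  also have "\<dots> = (\<Sum>p<n. \<Sum>b<n. \<Sum>a<n. ?h b j * (m a b p * tr n m p * ?h a i))"
    unfolding mul_def sum_distrib_left
    by (rule sum.cong[OF refl], subst sum.swap) (simp add: mult_ac)
  also have "\<dots> = (\<Sum>b<n. \<Sum>p<n. \<Sum>a<n. ?h b j * (m a b p * tr n m p * ?h a i))"
    by (rule sum.swap)
  also have "\<dots> = (\<Sum>b<n. \<Sum>a<n. \<Sum>p<n. ?h b j * (m a b p * tr n m p * ?h a i))"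
    by (intro sum.cong refl sum.swap)
  also have "\<dots> = (\<Sum>b<n. ?h b j * (\<Sum>a<n. gam n m a b * ?h a i))"
    unfolding gam_def by (simp add: sum_distrib_left sum_distrib_right)
  finally show ?thesis .
qed

section \<open>Left powers of a vector\<close>

lemma kry_cong:
  assumes "\<And>a. a < n \<Longrightarrow> u a = u' a" "a < n"
  shows "kry n m u i a = kry n m u' i a"
  using assms(2)
proof (induction i arbitrary: a)
  case (Suc i)
  have "mul n m u (kry n m u i) = mul n m u' (kry n m u' i)"
    using assms(1) Suc.IH by (intro mul_cong) auto
  then show ?case by simp
qed (use assms in simp)

text \<open>Entry \<open>i\<close> is homogeneous of degree i + 1 in \<open>u\<close>.\<close>

lemma kry_scale: "kry n m (\<lambda>a. c * u a) i a = c ^ Suc i * kry n m u i a"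
proof (induction i arbitrary: a)
  case (Suc i)
  have "kry n m (\<lambda>a. c * u a) (Suc i) a = mul n m (\<lambda>a. c * u a) (\<lambda>a. c ^ Suc i * kry n m u i a) a"
    using Suc.IH by (simp add: mul_def)
  also have "\<dots> = c ^ Suc (Suc i) * kry n m u (Suc i) a"
    unfolding mul_def kry.simps by (simp add: sum_distrib_left mult_ac)
  finally show ?case .
qed simp

lemma polyfun_kry:
  assumes "\<And>a. a < n \<Longrightarrow> (\<lambda>m. u m a) \<in> polyfun n" "a < n"
  shows "(\<lambda>m. kry n m (u m) i a) \<in> polyfun n"
  using assms(2)
proof (induction i arbitrary: a)
  case (Suc i)
  then show ?case
    unfolding kry.simps mul_def by (auto intro!: polyfun_sum polyfun.mult polyfun.coord assms(1))
qed (use assms in simp)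

text \<open>By the shift relations, the left powers of e_0 run through the standard basis.\<close>

lemma kry_normal_form:
  assumes m: "m \<in> normal_form n" and "a < n" "i < n"
  shows "kry n m (\<lambda>a. if a = 0 then 1 else 0) i a = (if a = i then 1 else 0)"
  using assms(2,3)
proof (induction i arbitrary: a)
  case (Suc i)
  let ?e = "\<lambda>a. if a = 0 then 1 else (0::'a)"
  have "kry n m ?e (Suc i) a = (\<Sum>b<n. \<Sum>c<n. m b c a * ?e b * (if c = i then 1 else 0))"
    unfolding kry.simps mul_def using Suc by (intro sum.cong refl) simp
  also have "\<dots> = (\<Sum>b<n. \<Sum>c<n. if c = i then if b = 0 then m b c a else 0 else 0)"
    by (intro sum.cong refl) auto
  also have "\<dots> = m 0 i a" using Suc.prems by simp
  finally show ?case using normal_formD(2)[OF m Suc.prems(2,1)] by simp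
qed simp

section \<open>Determinants and adjugates of matrices of polynomial functions\<close>

lemma permutes_lessThan: "p permutes {0..<k} \<Longrightarrow> i < k \<Longrightarrow> p i < k" for k :: nat
  using permutes_in_image[of p "{0..<k}" i] by simp

lemma polyfun_det:
  assumes "\<And>i j. i < k \<Longrightarrow> j < k \<Longrightarrow> F i j \<in> polyfun n"
  shows "(\<lambda>m. det (Matrix.mat k k (\<lambda>(i, j). F i j m))) \<in> polyfun n"
proof -
  have "(\<lambda>m. det (Matrix.mat k k (\<lambda>(i, j). F i j m))) =
      (\<lambda>m. \<Sum>p\<in>{p. p permutes {0..<k}}. signof p * (\<Prod>i\<in>{0..<k}. F i (p i) m))"
    unfolding det_def
    by (intro ext) (auto intro!: sum.cong prod.cong arg_cong2[of _ _ _ _ times]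
        simp: permutes_lessThan)
  also have "\<dots> \<in> polyfun n"
    by (intro polyfun_sum polyfun.mult polyfun.const polyfun_prod assms)
       (auto simp: permutes_lessThan)
  finally show ?thesis .
qed

text \<open>\<open>d\<close> and \<open>A\<close> stand for determinant and adjugate of
  \<open>M\<close>; the last clause records that the determinant is nonzero when the kernel is
  trivial.\<close>

definition adjugate_of ::
    "nat \<Rightarrow> (nat \<Rightarrow> nat \<Rightarrow> 'k::field tensor \<Rightarrow> 'k) \<Rightarrow> ('k tensor \<Rightarrow> 'k)
      \<Rightarrow> (nat \<Rightarrow> nat \<Rightarrow> 'k tensor \<Rightarrow> 'k) \<Rightarrow> bool" where
  "adjugate_of n M d A \<longleftrightarrow> (\<forall>i<n. \<forall>j<n. A i j \<in> polyfun n)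
    \<and> (\<forall>m. \<forall>i<n. \<forall>j<n. (\<Sum>k<n. M i k m * A k j m) = (if i = j then d m else 0))
    \<and> (\<forall>m. \<forall>i<n. \<forall>j<n. (\<Sum>k<n. A i k m * M k j m) = (if i = j then d m else 0))
    \<and> (\<forall>m. (\<forall>x. (\<forall>i<n. (\<Sum>j<n. M i j m * x j) = 0) \<longrightarrow> (\<forall>j<n. x j = 0)) \<longrightarrow> d m \<noteq> 0)"

lemma adjugate_ofD:
  assumes "adjugate_of n M d A"
  shows "i < n \<Longrightarrow> j < n \<Longrightarrow> A i j \<in> polyfun n"
    "i < n \<Longrightarrow> j < n \<Longrightarrow> (\<Sum>k<n. M i k m * A k j m) = (if i = j then d m else 0)"
    "i < n \<Longrightarrow> j < n \<Longrightarrow> (\<Sum>k<n. A i k m * M k j m) = (if i = j then d m else 0)"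
    "(\<And>x j. \<forall>i<n. (\<Sum>j<n. M i j m * x j) = 0 \<Longrightarrow> j < n \<Longrightarrow> x j = 0) \<Longrightarrow> d m \<noteq> 0"
  using assms unfolding adjugate_of_def by blast+

text \<open>Entries of the adjugate are signed minors, hence polynomial in the entries of
  \<open>M\<close>.\<close>

lemma adjugate_polyfun:
  fixes M :: "nat \<Rightarrow> nat \<Rightarrow> 'k::field tensor \<Rightarrow> 'k"
  assumes M: "\<And>i j. i < n \<Longrightarrow> j < n \<Longrightarrow> M i j \<in> polyfun n"
  shows "\<exists>d\<in>polyfun n. \<exists>A. adjugate_of n M d A"
proof -
  define B where "B m = Matrix.mat n n (\<lambda>(i, j). M i j m)" for m
  have B: "B m \<in> carrier_mat n n" for m unfolding B_def by simp
  have Bij: "B m $$ (i, j) = M i j m" if "i < n" "j < n" for i j m using that unfolding B_def by simp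
  define d where "d = (\<lambda>m. det (B m))"
  define A where "A i j = (\<lambda>m. adj_mat (B m) $$ (i, j))" for i j
  have 1: "d \<in> polyfun n" unfolding d_def B_def by (rule polyfun_det[OF M])
  have 2: "A i j \<in> polyfun n" if ij: "i < n" "j < n" for i j
  proof -
    \<comment> \<open>\<open>del k\<close> enumerates the indices other than \<open>k\<close>, in
      the manner of \<open>mat_delete\<close>.\<close>
    define del where "del k l = (if l < k then l else Suc l)" for k l :: nat
    have del: "del k l < n" if "l < n - 1" for k l using that unfolding del_def by auto
    have "A i j = (\<lambda>m. (-1) ^ (j + i) *
        det (Matrix.mat (n - 1) (n - 1) (\<lambda>(a, b). M (del j a) (del i b) m)))"
    proof
      fix m
      have "mat_delete (B m) j i = Matrix.mat (n - 1) (n - 1) (\<lambda>(a, b). M (del j a) (del i b) m)"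
        unfolding mat_delete_def using B[of m]
        by (intro cong_mat) (auto simp: B_def del_def)
      then show "A i j m = (-1) ^ (j + i) *
          det (Matrix.mat (n - 1) (n - 1) (\<lambda>(a, b). M (del j a) (del i b) m))"
        unfolding A_def adj_mat_def cofactor_def using ij B[of m] by simp
    qed
    also have "\<dots> \<in> polyfun n"
      by (intro polyfun.mult polyfun.const polyfun_det M del)
    finally show ?thesis .
  qed
  note adj = adj_mat[OF B]
  have Aij: "adj_mat (B m) $$ (i, j) = A i j m" for m i j unfolding A_def ..
  have 3: "(\<Sum>k<n. M i k m * A k j m) = (if i = j then d m else 0)" if ij: "i < n" "j < n" for m i j
  proof -
    have "(\<Sum>k<n. M i k m * A k j m) = (B m * adj_mat (B m)) $$ (i, j)"
      using ij B[of m] adj(1)[of m]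
      by (simp add: scalar_prod_def Bij Aij atLeast0LessThan)
    then show ?thesis unfolding adj(2) d_def using ij by simp
  qed
  have 4: "(\<Sum>k<n. A i k m * M k j m) = (if i = j then d m else 0)" if ij: "i < n" "j < n" for m i j
  proof -
    have "(\<Sum>k<n. A i k m * M k j m) = (adj_mat (B m) * B m) $$ (i, j)"
      using ij B[of m] adj(1)[of m]
      by (simp add: scalar_prod_def Bij Aij atLeast0LessThan)
    then show ?thesis unfolding adj(3) d_def using ij by simp
  qed
  have 5: "d m \<noteq> 0"
    if ker: "\<forall>x. (\<forall>i<n. (\<Sum>j<n. M i j m * x j) = 0) \<longrightarrow> (\<forall>j<n. x j = 0)" for m
  proof
    assume "d m = 0"
    then obtain v where v: "v \<in> carrier_vec n" "v \<noteq> 0\<^sub>v n" "B m *\<^sub>v v = 0\<^sub>v n"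
      using det_0_iff_vec_prod_zero_field[OF B] unfolding d_def by blast
    have "(\<Sum>j<n. M i j m * v $ j) = 0" if i: "i < n" for i
    proof -
      have "(\<Sum>j<n. M i j m * v $ j) = (B m *\<^sub>v v) $ i"
        using i B[of m] v(1) by (simp add: scalar_prod_def Bij atLeast0LessThan)
      then show ?thesis using v(3) i by simp
    qed
    then have "v $ j = 0" if "j < n" for j using ker that by blast
    then have "v = 0\<^sub>v n" using v(1) by (intro eq_vecI) auto
    then show False using v(2) by blast
  qed
  show ?thesis
    by (rule bexI[OF _ 1], rule exI[of _ A], unfold adjugate_of_def, intro conjI allI impI) (simp_all only: 2 3 4 5 not_False_eq_True)
qed

section \<open>The normalizing group element\<close>

text \<open>\<open>t\<close> is the product of two determinants: \<open>d1\<close> governs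
  solvability for \<open>v\<close>, and \<open>d2\<close> independence of its left powers.
  \<open>G m\<close> is the inverse of the matrix \<open>E m\<close> having these powers as
  columns.\<close>

lemma normalizing_element:
  "\<exists>t G. t \<in> polyfun n \<and> t (witness n :: 'k::field tensor) \<noteq> 0
    \<and> (\<forall>m. t m \<noteq> 0 \<longrightarrow> G m \<in> gl n)
    \<and> (\<forall>i<n. \<forall>j<n. \<forall>l<n. regular n t (\<lambda>m. act n (G m) m i j l))
    \<and> (\<forall>m\<in>symtens n. t m \<noteq> 0 \<longrightarrow> act n (G m) m \<in> normal_form n)
    \<and> (\<forall>m\<in>symtens n. \<forall>g\<in>gl n. t m \<noteq> 0 \<longrightarrow> act n g m \<in> normal_form n \<longrightarrow> g = G m)"
proof -
  have tr_poly: "(\<lambda>m::'k tensor. tr n m a) \<in> polyfun n" if "a < n" for a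
    unfolding tr_def using that by (intro polyfun_sum polyfun.coord) auto
  have gam_poly: "(\<lambda>m::'k tensor. gam n m a b) \<in> polyfun n" if "a < n" "b < n" for a b
    unfolding gam_def using that by (intro polyfun_sum polyfun.mult polyfun.coord tr_poly) auto
  obtain d1 A1 where d1: "d1 \<in> polyfun n"
    and adj1: "adjugate_of n (\<lambda>i j m :: 'k tensor. gam n m i j) d1 A1"
    using adjugate_polyfun[of n "\<lambda>i j m. gam n m i j", OF gam_poly] by blast
  note A1 = adjugate_ofD(1)[OF adj1] and gA = adjugate_ofD(2)[OF adj1]
    and Ag = adjugate_ofD(3)[OF adj1] and d1_nz = adjugate_ofD(4)[OF adj1]
  \<comment> \<open>The numerator of \<open>v\<close> in Cramer's rule; unlike \<open>v\<close> it
    is polynomial in \<open>m\<close>.\<close>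
  define w where "w m = mv n (\<lambda>i k. A1 i k m) (tr n m)" for m
  have w_poly: "(\<lambda>m. w m a) \<in> polyfun n" if "a < n" for a
    unfolding w_def mv_def using that by (intro polyfun_sum polyfun.mult A1 tr_poly) auto
  have kry_poly: "(\<lambda>m. kry n m (w m) i a) \<in> polyfun n" if "a < n" for a i
    by (rule polyfun_kry[OF w_poly that])
  obtain d2 A2 where d2: "d2 \<in> polyfun n"
    and adj2: "adjugate_of n (\<lambda>i j m :: 'k tensor. kry n m (w m) j i) d2 A2"
    using adjugate_polyfun[of n "\<lambda>i j m. kry n m (w m) j i", OF kry_poly] by blast
  note A2 = adjugate_ofD(1)[OF adj2] and AK = adjugate_ofD(3)[OF adj2]
    and KA = adjugate_ofD(2)[OF adj2] and d2_nz = adjugate_ofD(4)[OF adj2]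
  define v where "v m a = inverse (d1 m) * w m a" for m a
  define t where "t m = d1 m * d2 m" for m
  define E where "E m a i = (if a < n \<and> i < n then kry n m (v m) i a else 0)" for m a i
  \<comment> \<open>Column i of \<open>E m\<close> is the left power of \<open>w m\<close> divided
    by d1^(i + 1), so in the inverse, row l of the adjugate \<open>A2\<close> is multiplied by d1^(l
    + 1) and divided by \<open>d2\<close>.\<close>
  define G where "G m l c = (if l < n \<and> c < n then d1 m ^ Suc l * A2 l c m * inverse (d2 m) else 0)"
    for m l c
  have kry_v: "kry n m (v m) i a = inverse (d1 m) ^ Suc i * kry n m (w m) i a" for m i a
    using kry_scale[of n m "inverse (d1 m)" "w m" i a] unfolding v_def by simp

  \<comment> \<open>Uniqueness half of Cramer's rule: multiply the system by the adjugate from the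
    left.\<close>
  have w_solve: "w m a = d1 m * u a"
    if a: "a < n" and u: "\<And>c. c < n \<Longrightarrow> (\<Sum>b<n. gam n m c b * u b) = tr n m c" for m u a
  proof -
    have "w m a = (\<Sum>c<n. \<Sum>b<n. A1 a c m * (gam n m c b * u b))"
      unfolding w_def mv_def by (intro sum.cong refl) (simp add: u[symmetric] sum_distrib_left)
    also have "\<dots> = (\<Sum>b<n. \<Sum>c<n. A1 a c m * (gam n m c b * u b))" by (rule sum.swap)
    also have "\<dots> = (\<Sum>b<n. (\<Sum>c<n. A1 a c m * gam n m c b) * u b)"
      by (simp add: sum_distrib_right mult.assoc)
    also have "\<dots> = (\<Sum>b<n. if b = a then d1 m * u b else 0)"
      using a by (intro sum.cong refl) (auto simp: Ag)
    finally show ?thesis using a by simp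
  qed
  \<comment> \<open>Existence half: here the adjugate stands on the right.\<close>
  have gam_v: "(\<Sum>b<n. gam n m c b * v m b) = tr n m c" if c: "c < n" and d: "d1 m \<noteq> 0" for m c
  proof -
    have "(\<Sum>b<n. gam n m c b * v m b)
        = inverse (d1 m) * (\<Sum>b<n. \<Sum>k<n. gam n m c b * (A1 b k m * tr n m k))"
      unfolding v_def w_def mv_def by (simp add: sum_distrib_left mult_ac)
    also have "(\<Sum>b<n. \<Sum>k<n. gam n m c b * (A1 b k m * tr n m k))
        = (\<Sum>k<n. \<Sum>b<n. gam n m c b * (A1 b k m * tr n m k))" by (rule sum.swap)
    also have "\<dots> = (\<Sum>k<n. (\<Sum>b<n. gam n m c b * A1 b k m) * tr n m k)"
      by (simp add: sum_distrib_right mult.assoc)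
    also have "\<dots> = (\<Sum>k<n. if k = c then d1 m * tr n m k else 0)"
      using c by (intro sum.cong refl) (auto simp: gA)
    finally show ?thesis using c d by simp
  qed

  have GE: "is_mat_inv n (G m) (E m)" if t: "t m \<noteq> 0" for m
    unfolding is_mat_inv_def
  proof (intro conjI allI impI)
    have d: "d1 m \<noteq> 0" "d2 m \<noteq> 0" using t unfolding t_def by auto
    show "E m i j = 0" if "\<not> (i < n \<and> j < n)" for i j using that unfolding E_def by auto
    fix i j assume ij: "i < n" "j < n"
    have "(\<Sum>k<n. G m i k * E m k j)
        = d1 m ^ Suc i * inverse (d2 m) * inverse (d1 m) ^ Suc j * (\<Sum>k<n. A2 i k m * kry n m (w m) j k)"
      unfolding sum_distrib_left
      by (intro sum.cong refl) (use ij in \<open>simp add: G_def E_def kry_v mult_ac\<close>)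
    then show "(\<Sum>k<n. G m i k * E m k j) = (if i = j then 1 else 0)"
      using d unfolding AK[OF ij]
      by (cases "i = j") (simp_all del: power_Suc add: power_inverse field_simps)
    have "(\<Sum>k<n. E m i k * G m k j)
        = inverse (d2 m) * (\<Sum>k<n. kry n m (w m) k i * A2 k j m)"
      unfolding sum_distrib_left
      by (intro sum.cong refl) (use ij d in \<open>simp del: power_Suc add: G_def E_def kry_v power_inverse field_simps\<close>)
    then show "(\<Sum>k<n. E m i k * G m k j) = (if i = j then 1 else 0)"
      using d ij by (simp add: KA)
  qed
  have G_gl: "G m \<in> gl n" if "t m \<noteq> 0" for m
    by (rule gl_I[OF GE[OF that]]) (auto simp: G_def)
  have inv_G: "gl_inv n (G m) = E m" if "t m \<noteq> 0" for m
    by (rule gl_inv_eq[OF GE[OF that]])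

  have t_poly: "t \<in> polyfun n" unfolding t_def by (intro polyfun.mult d1 d2)
  have reg1: "regular n t (\<lambda>m. inverse (d1 m))"
    by (rule regular_inverse_factor[OF _ d2]) (simp add: t_def)
  have reg2: "regular n t (\<lambda>m. inverse (d2 m))"
    by (rule regular_inverse_factor[OF _ d1]) (simp add: t_def)
  have G_reg: "regular n t (\<lambda>m. G m l c)" if "l < n" "c < n" for l c
  proof -
    have "(\<lambda>m. G m l c) = (\<lambda>m. d1 m ^ Suc l * A2 l c m * inverse (d2 m))"
      unfolding G_def using that by simp
    moreover have "regular n t (\<lambda>m. d1 m ^ Suc l * A2 l c m * inverse (d2 m))"
      by (rule regular_mult[OF regular_polyfun[OF polyfun.mult[OF polyfun_power[OF d1] A2[OF that]]] reg2])
    ultimately show ?thesis by simp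
  qed
  have E_reg: "regular n t (\<lambda>m. E m a i)" if "a < n" "i < n" for a i
  proof -
    have "(\<lambda>m. E m a i) = (\<lambda>m. inverse (d1 m) ^ Suc i * kry n m (w m) i a)"
      unfolding E_def kry_v using that by simp
    moreover have "regular n t (\<lambda>m. inverse (d1 m) ^ Suc i * kry n m (w m) i a)"
      by (rule regular_mult[OF regular_power[OF reg1] regular_polyfun[OF kry_poly[OF that(1)]]])
    ultimately show ?thesis by simp
  qed
  have act_reg: "regular n t (\<lambda>m. act n (G m) m i j l)" if ijl: "i < n" "j < n" "l < n" for i j l
  proof (rule regular_cong)
    show "act n (G m) m i j l = (\<Sum>a<n. \<Sum>b<n. \<Sum>c<n. G m l c * m a b c * E m a i * E m b j)"
      if "t m \<noteq> 0" for m
      unfolding act_def inv_G[OF that] using ijl by simp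
    show "regular n t (\<lambda>m. \<Sum>a<n. \<Sum>b<n. \<Sum>c<n. G m l c * m a b c * E m a i * E m b j)"
      using ijl
      by (intro regular_sum[OF t_poly] regular_mult G_reg E_reg regular_polyfun[OF polyfun.coord]) auto
  qed

  have act_normal: "act n (G m) m \<in> normal_form n" if m: "m \<in> symtens n" and t: "t m \<noteq> 0" for m
  proof (rule normal_formI[OF act_symtens[OF m]])
    have d: "d1 m \<noteq> 0" "d2 m \<noteq> 0" using t unfolding t_def by auto
    have E0: "E m a 0 = v m a" if "a < n" for a using that unfolding E_def by simp
    show "act n (G m) m 0 i l = (if l = Suc i then 1 else 0)" if il: "Suc i < n" "l < n" for i l
    proof -
      have "act n (G m) m 0 i l = mv n (G m) (mul n m (\<lambda>a. E m a 0) (\<lambda>a. E m a i)) l"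
        using il by (simp add: act_eq_mv_mul inv_G[OF t])
      \<comment> \<open>The product of column 0 with column i of \<open>E m\<close> is the next left
        power, that is column i + 1, which \<open>G m\<close> sends to e_(i+1).\<close>
      also have "mul n m (\<lambda>a. E m a 0) (\<lambda>a. E m a i) = kry n m (v m) (Suc i)"
        unfolding kry.simps using il by (intro mul_cong) (auto simp: E_def)
      also have "mv n (G m) (kry n m (v m) (Suc i)) l = (\<Sum>k<n. G m l k * E m k (Suc i))"
        unfolding mv_def using il by (intro sum.cong refl) (simp add: E_def)
      also have "\<dots> = (if l = Suc i then 1 else 0)"
        using GE[OF t] il unfolding is_mat_inv_def by blast
      finally show ?thesis .
    qed
    show "gam n (act n (G m) m) 0 j = tr n (act n (G m) m) j" if j: "j < n" for j
    proof -
      have "gam n (act n (G m) m) 0 j = (\<Sum>b<n. E m b j * (\<Sum>a<n. gam n m b a * v m a))"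
        using j gam_act[OF G_gl[OF t], of 0 j m]
        by (simp add: inv_G[OF t] E0 gam_sym[OF m, of _ b for b])
      then show ?thesis
        using j by (simp add: gam_v d tr_act[OF G_gl[OF t]] inv_G[OF t])
    qed
    \<comment> \<open>If all new traces vanished, so would those of \<open>m\<close> and hence
      \<open>v\<close>, but \<open>v\<close> is column 0 of an invertible matrix.\<close>
    show "\<exists>j<n. tr n (act n (G m) m) j \<noteq> 0" if n: "0 < n"
    proof (rule ccontr)
      assume no: "\<not> ?thesis"
      have "tr n m c = 0" if "c < n" for c
        using tr_pull[OF G_gl[OF t] that, of m] no by simp
      then have "w m a = 0" for a unfolding w_def mv_def by simp
      then have "E m a 0 = 0" if "a < n" for a using E0[OF that] unfolding v_def by simp
      then have "(\<Sum>k<n. G m 0 k * E m k 0) = 0" by simp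
      then show False using GE[OF t] n unfolding is_mat_inv_def by auto
    qed
  qed

  have unique: "g = G m"
    if m: "m \<in> symtens n" and g: "g \<in> gl n" and t: "t m \<noteq> 0"
      and N: "act n g m \<in> normal_form n" for m g
  proof -
    let ?h = "gl_inv n g"
    have d: "d1 m \<noteq> 0" "d2 m \<noteq> 0" using t unfolding t_def by auto
    \<comment> \<open>Pulling gam(e_0, x) = tr(x) back along \<open>g\<close> shows that g^-1 e_0
      solves the system that determines \<open>v\<close>.\<close>
    have "(\<Sum>b<n. gam n m c b * ?h b 0) = tr n m c" if c: "c < n" for c
    proof -
      have "tr n m c = (\<Sum>j<n. gam n (act n g m) 0 j * g j c)"
        using tr_pull[OF g c, of m] normal_form_gam[OF N] by simp
      also have "\<dots> = (\<Sum>j<n. (\<Sum>b<n. ?h b j * (\<Sum>a<n. gam n m a b * ?h a 0)) * g j c)"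
        using c by (intro sum.cong refl) (simp add: gam_act[OF g])
      also have "\<dots> = (\<Sum>a<n. gam n m a c * ?h a 0)"
        by (rule sum_matrix_cancel[OF gl_inv_inverse[OF g] c])
      finally show ?thesis by (simp add: gam_sym[OF m, of c])
    qed
    then have h0: "?h a 0 = v m a" if "a < n" for a
      using w_solve[OF that, of m "\<lambda>b. ?h b 0"] d by (simp add: v_def)
    \<comment> \<open>The relations e_0 e_i = e_(i+1) pull back to the recursion of
      \<open>kry\<close>, so every column of g^-1 is forced.\<close>
    have hE: "?h p i = kry n m (v m) i p" if "i < n" "p < n" for i p
      using that
    proof (induction i arbitrary: p)
      case 0
      then show ?case using h0 by simp
    next
      case (Suc i)
      have "?h p (Suc i) = (\<Sum>l<n. if l = Suc i then ?h p l else 0)" using Suc.prems by simp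
      also have "\<dots> = (\<Sum>l<n. ?h p l * act n g m 0 i l)"
        using Suc.prems by (intro sum.cong refl) (auto simp: normal_formD(2)[OF N])
      also have "\<dots> = mul n m (\<lambda>a. ?h a 0) (\<lambda>a. ?h a i) p"
        using Suc.prems by (intro act_pull[OF g]) auto
      also have "\<dots> = mul n m (v m) (kry n m (v m) i) p"
      proof (intro fun_cong[OF mul_cong])
        fix a assume a: "a < n"
        show "?h a i = kry n m (v m) i a" using Suc.IH[OF _ a] Suc.prems by simp
        show "?h a 0 = v m a" by (rule h0[OF a])
      qed
      finally show ?case by simp
    qed
    have "?h = E m"
    proof (intro ext)
      fix p i
      show "?h p i = E m p i"
        using hE is_mat_inv_outside[OF gl_inv_inverse[OF g], of p i] unfolding E_def by auto
    qed
    then have "is_mat_inv n (E m) g" using is_mat_inv_sym[OF gl_inv_inverse[OF g] g] by simp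
    then show ?thesis
      using is_mat_inv_unique is_mat_inv_sym[OF GE[OF t] G_gl[OF t]] by blast
  qed

  \<comment> \<open>At the witness the trace form is nondegenerate and v = e_0, so the left powers
    of w = d1 e_0 form a diagonal matrix with entries d1^(j + 1).\<close>
  have "t (witness n) \<noteq> 0"
  proof -
    let ?m = "witness n :: 'k tensor"
    let ?e = "\<lambda>a. if a = 0 then 1 else (0::'k)"
    have d: "d1 ?m \<noteq> 0"
      by (rule d1_nz) (use gam_witness_nondegenerate[where 'k = 'k] in blast)
    have w: "w ?m a = d1 ?m * ?e a" if "a < n" for a
    proof (rule w_solve[OF that])
      fix c assume c: "c < n"
      have "(\<Sum>b<n. gam n ?m c b * ?e b) = (\<Sum>b<n. if b = 0 then gam n ?m c b else 0)"
        by (intro sum.cong refl) auto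
      then show "(\<Sum>b<n. gam n ?m c b * ?e b) = tr n ?m c"
        using c by (auto simp: gam_witness tr_witness)
    qed
    have K: "kry n ?m (w ?m) j i = d1 ?m ^ Suc j * (if i = j then 1 else 0)"
      if "i < n" "j < n" for i j
      using kry_cong[of n "w ?m" "\<lambda>a. d1 ?m * ?e a" i ?m j, OF w that(1)]
        kry_scale[of n ?m "d1 ?m" ?e j i] kry_normal_form[OF witness_normal_form[where 'k = 'k] that]
      by simp
    have "d2 ?m \<noteq> 0"
    proof (rule d2_nz)
      fix x j assume x: "\<forall>i<n. (\<Sum>j<n. kry n ?m (w ?m) j i * x j) = 0" and j: "j < n"
      have "(\<Sum>i<n. kry n ?m (w ?m) i j * x i) = (\<Sum>i<n. if i = j then d1 ?m ^ Suc i * x i else 0)"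
        using j by (intro sum.cong refl) (auto simp: K)
      then have "d1 ?m ^ Suc j * x j = 0" using x j by simp
      then show "x j = 0" using d by simp
    qed
    then show ?thesis using d unfolding t_def by simp
  qed
  then show ?thesis using t_poly G_gl act_reg act_normal unique by blast
qed

section \<open>Equations of the slice and conclusion\<close>

definition normal_form_eqs :: "nat \<Rightarrow> ('k::comm_ring_1 tensor \<Rightarrow> 'k) set" where
  "normal_form_eqs n =
     (\<lambda>(i, l) m. m 0 i l - (if l = Suc i then 1 else 0)) ` ({..<n - 1} \<times> {..<n})
     \<union> (if n = 0 then {} else {\<lambda>m. (\<Sum>l<n. m 0 (n - 1) l) - 1})
     \<union> (\<lambda>j m. tr n m j - m 0 (n - 1) (n - 1)) ` {..<n}"

lemma normal_form_eqs_finite: "finite (normal_form_eqs n)"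
  unfolding normal_form_eqs_def by auto

lemma normal_form_eqs_polyfun: "normal_form_eqs n \<subseteq> polyfun n"
  unfolding normal_form_eqs_def tr_def
  by (auto intro!: polyfun_minus polyfun_sum polyfun.coord polyfun.const)

text \<open>For \<open>n = 0\<close> the coordinate-sum equation would read -1 = 0, hence the case
  distinction in \<open>normal_form_eqs\<close>; for positive \<open>n\<close> the range
  \<open>{..<n - 1}\<close> matches \<open>Suc i < n\<close>.\<close>

lemma normal_form_eq: "normal_form n = {m \<in> symtens n. \<forall>s\<in>normal_form_eqs n. s m = 0}"
proof (cases "n = 0")
  case True
  then show ?thesis unfolding normal_form_def normal_form_eqs_def by simp
next
  case False
  then have "Suc i < n \<longleftrightarrow> i < n - 1" for i by auto
  then show ?thesis
    unfolding normal_form_def normal_form_eqs_def using False by (auto simp: ball_Un)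
qed

theorem theorem5:
  fixes n :: nat
  assumes "alg_closed TYPE('k::field)"
    and "(2::'k) \<noteq> 0"
  shows "\<exists>P Q :: ('k tensor \<Rightarrow> 'k) set.
     finite P \<and> finite Q \<and> P \<subseteq> polyfun n \<and> Q \<subseteq> polyfun n
     \<and> (\<forall>f \<in> P \<union> Q. nonconst n f)
     \<and> (let S = {m \<in> symtens n. \<forall>s\<in>P. s m = 0};
            U = {m \<in> symtens n. \<forall>t\<in>Q. t m \<noteq> 0}
        in zirreducible n S \<and> restriction_iso n S
           \<and> zdense n U
           \<and> (\<forall>a\<in>U. \<exists>!g. g \<in> gl n \<and> act n g a \<in> S))"
proof -
  have inf: "infinite (UNIV :: 'k set)" by (rule alg_closed_infinite[OF assms(1)])
  obtain t G where t: "t \<in> polyfun n" "t (witness n :: 'k tensor) \<noteq> 0"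
    and G: "\<And>m. t m \<noteq> 0 \<Longrightarrow> G m \<in> gl n"
    and reg: "\<And>i j l. i < n \<Longrightarrow> j < n \<Longrightarrow> l < n \<Longrightarrow> regular n t (\<lambda>m. act n (G m) m i j l)"
    and nf: "\<And>m. m \<in> symtens n \<Longrightarrow> t m \<noteq> 0 \<Longrightarrow> act n (G m) m \<in> normal_form n"
    and unique: "\<And>m g. m \<in> symtens n \<Longrightarrow> g \<in> gl n \<Longrightarrow> t m \<noteq> 0 \<Longrightarrow> act n g m \<in> normal_form n
                   \<Longrightarrow> g = G m"
    using normalizing_element[of n] by blast
  let ?S = "normal_form n :: 'k tensor set"
  have wS: "witness n \<in> ?S" and wC: "(witness n :: 'k tensor) \<in> symtens n"
    using witness_normal_form witness_symtens by auto
  have primeC: "poly_prime n (symtens n :: 'k tensor set)"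
    using affine_set_poly_prime[OF inf symtens_affine] wC by blast
  have primeS: "poly_prime n ?S"
    using affine_set_poly_prime[OF inf normal_form_affine] wS by blast
  \<comment> \<open>Uniqueness of the group element carries over to the point that it produces in
    the slice.\<close>
  interpret rational_section n ?S t "\<lambda>m. act n (G m) m"
  proof
    show "?S \<subseteq> symtens n" using normal_formD(1) by blast
    show "\<exists>m\<in>?S. t m \<noteq> 0" using wS t(2) by blast
    show "act n g m = act n (G m) m"
      if "m \<in> symtens n" "t m \<noteq> 0" "g \<in> gl n" "act n g m \<in> ?S" for m g
      using unique[OF that(1,3,2,4)] by simp
  qed (use primeC primeS t G reg nf in blast)+
  \<comment> \<open>Constant equations, such as the trace equation for \<open>n = 1\<close>, are
    discarded; they vanish at the witness, hence everywhere.\<close>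
  define P where "P = {f \<in> normal_form_eqs n. nonconst n (f :: 'k tensor \<Rightarrow> 'k)}"
  define Q where "Q = {f \<in> {t}. nonconst n f}"
  have S: "{m \<in> symtens n. \<forall>s\<in>P. s m = 0} = ?S"
  proof -
    have "s m = 0" if "s \<in> normal_form_eqs n" "\<not> nonconst n s" "m \<in> symtens n"
      for s :: "'k tensor \<Rightarrow> 'k" and m
    proof -
      have "s (witness n) = 0" using that(1) wS unfolding normal_form_eq by blast
      then show ?thesis using that(2,3) wC unfolding nonconst_def by metis
    qed
    then show ?thesis unfolding P_def normal_form_eq by blast
  qed
  have U: "{m \<in> symtens n. \<forall>f\<in>Q. f m \<noteq> 0} = {m \<in> symtens n. t m \<noteq> 0}"
  proof -
    \<comment> \<open>A constant \<open>t\<close> is nonzero everywhere, since it is so at the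
      witness; dropping it leaves the open set unchanged.\<close>
    have "t m \<noteq> 0" if "\<not> nonconst n t" "m \<in> symtens n" for m
      using that wC t(2) unfolding nonconst_def by metis
    then show ?thesis unfolding Q_def by blast
  qed
  have "\<exists>!g. g \<in> gl n \<and> act n g a \<in> ?S" if "a \<in> symtens n" "t a \<noteq> 0" for a
    using unique[of a] G[of a] nf[of a] that by blast
  moreover have "finite P"
    unfolding P_def by (rule finite_subset[OF _ normal_form_eqs_finite]) auto
  moreover have "P \<subseteq> polyfun n" "finite Q" "Q \<subseteq> polyfun n"
    "\<forall>f \<in> P \<union> Q. nonconst n f"
    unfolding P_def Q_def using normal_form_eqs_polyfun t(1) by auto
  moreover have "zirreducible n ?S" by (rule zirreducible_poly_prime[OF primeS S_sub])
  moreover have "zdense n {m \<in> symtens n. t m \<noteq> 0}"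
    by (rule zdense_nonvanishing[OF primeC t(1) wC t(2)])
  ultimately show ?thesis
    using restriction_iso_section by (intro exI[of _ P] exI[of _ Q]) (simp add: S U Let_def)
qed

end
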